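(* Let $G$ be a finite Coxeter group. Then the Bogomolov multiplier of $G$ vanishes: $B(G)=0$. Equivalently, the Schur multiplier $M(G)=H_2(G,\mathbb{Z})$ is generated by toral classes.
   Context: A finite Coxeter group is a finite group $G$ admitting a presentation $\langle r_1,\dots,r_n \mid (r_ir_j)^{m_{ij}}=1,\ 1\le i,j\le n\rangle$ with $m_{ii}=1$ and $m_{ij}=m_{ji}\in\{2,3,\dots\}$ for $i\neq j$. For a finite group $G$, the Schur multiplier is $M(G)=H_2(G,\mathbb{Z})=H_2(BG,\mathbb{Z})$, where $BG$ is the classifying space. A class in $M(G)$ is called toral if it has the form $f_*[S^1\times S^1]$ for some continuous map $f:S^1\times S^1\to BG$ (equivalently, for the map determined up to homotopy by a homomorphism $\mathbb{Z}\times\mathbb{Z}\to G$, i.e. by a pair of commuting elements of $G$) and some choice of orientation class $[S^1\times S^1]\in H_2(S^1\times S^1,\mathbb{Z})\cong\mathbb{Z}$. Let $M_0(G)\le M(G)$ be the subgroup generated by all toral classes. The Bogomolov multiplier is $B(G)=M(G)/M_0(G)$. *)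

theory Defs
  imports "HOL-Algebra.Free_Abelian_Groups"
begin

section \<open>Group presentations and finite Coxeter groups\<close>

text \<open>A letter \<open>(x, True)\<close> stands for the generator \<open>x\<close>, and \<open>(x, False)\<close> for its formal inverse.\<close>

type_synonym 'x word = "('x \<times> bool) list"

definition words :: "'x set \<Rightarrow> 'x word set" where
  "words X = lists (X \<times> UNIV)"

inductive pres_equiv :: "'x set \<Rightarrow> 'x word set \<Rightarrow> 'x word \<Rightarrow> 'x word \<Rightarrow> bool"
  for X :: "'x set" and R :: "'x word set" where
  refl: "u \<in> words X \<Longrightarrow> pres_equiv X R u u"
| sym: "pres_equiv X R u v \<Longrightarrow> pres_equiv X R v u"
| trans: "pres_equiv X R u v \<Longrightarrow> pres_equiv X R v w \<Longrightarrow> pres_equiv X R u w"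
| cancel: "u \<in> words X \<Longrightarrow> v \<in> words X \<Longrightarrow> x \<in> X \<Longrightarrow>
    pres_equiv X R (u @ [(x, b), (x, \<not> b)] @ v) (u @ v)"
| relator: "u \<in> words X \<Longrightarrow> v \<in> words X \<Longrightarrow> w \<in> R \<Longrightarrow> w \<in> words X \<Longrightarrow>
    pres_equiv X R (u @ w @ v) (u @ v)"

definition pres_class :: "'x set \<Rightarrow> 'x word set \<Rightarrow> 'x word \<Rightarrow> 'x word set" where
  "pres_class X R u = {v. pres_equiv X R u v}"

text \<open>The group \<open>\<langle>X | R\<rangle>\<close>.\<close>

definition presented_group :: "'x set \<Rightarrow> 'x word set \<Rightarrow> 'x word set monoid" where
  "presented_group X R =
    \<lparr>carrier = pres_class X R ` words X,
     monoid.mult = (\<lambda>A B. \<Union>u\<in>A. \<Union>v\<in>B. pres_class X R (u @ v)),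
     one = pres_class X R []\<rparr>"

definition coxeter_matrix :: "nat \<Rightarrow> (nat \<Rightarrow> nat \<Rightarrow> nat) \<Rightarrow> bool" where
  "coxeter_matrix n m \<longleftrightarrow>
    (\<forall>i\<in>{1..n}. m i i = 1) \<and>
    (\<forall>i\<in>{1..n}. \<forall>j\<in>{1..n}. i \<noteq> j \<longrightarrow> m i j = m j i \<and> 2 \<le> m i j)"

definition coxeter_relators :: "nat \<Rightarrow> (nat \<Rightarrow> nat \<Rightarrow> nat) \<Rightarrow> nat word set" where
  "coxeter_relators n m =
    {concat (replicate (m i j) [(i, True), (j, True)]) | i j. i \<in> {1..n} \<and> j \<in> {1..n}}"

definition finite_coxeter_group :: "('a, 'b) monoid_scheme \<Rightarrow> bool" where
  "finite_coxeter_group G \<longleftrightarrow> group G \<and> finite (carrier G) \<and>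
    (\<exists>n m. coxeter_matrix n m \<and> G \<cong> presented_group {1..n} (coxeter_relators n m))"


section \<open>Integral group homology\<close>

text \<open>
  \<open>H\<^sub>n(G, \<int>)\<close> is the homology of the inhomogeneous bar complex, i.e. of the chain complex of the
  nerve of \<open>G\<close>, whose realisation is \<open>BG\<close>. The list \<open>[g\<^sub>1, \<dots>, g\<^sub>n]\<close> is the simplex \<open>[g\<^sub>1|\<dots>|g\<^sub>n]\<close>.
\<close>

definition bar_simplices :: "nat \<Rightarrow> ('a, 'b) monoid_scheme \<Rightarrow> 'a list set" where
  "bar_simplices n G = {gs \<in> lists (carrier G). length gs = n}"

definition bar_face :: "('a, 'b) monoid_scheme \<Rightarrow> nat \<Rightarrow> 'a list \<Rightarrow> 'a list" where
  "bar_face G i gs =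
    (if i = 0 then tl gs
     else if i = length gs then butlast gs
     else take (i - 1) gs @ [gs ! (i - 1) \<otimes>\<^bsub>G\<^esub> gs ! i] @ drop (i + 1) gs)"

definition bar_boundary ::
    "nat \<Rightarrow> ('a, 'b) monoid_scheme \<Rightarrow> ('a list \<Rightarrow>\<^sub>0 int) \<Rightarrow> ('a list \<Rightarrow>\<^sub>0 int)" where
  "bar_boundary n G c =
    (if n = 0 then 0
     else frag_extend (\<lambda>gs. \<Sum>i\<le>n. frag_cmul ((-1) ^ i) (frag_of (bar_face G i gs))) c)"

definition bar_chain_group :: "nat \<Rightarrow> ('a, 'b) monoid_scheme \<Rightarrow> ('a list \<Rightarrow>\<^sub>0 int) monoid" where
  "bar_chain_group n G = free_Abelian_group (bar_simplices n G)"

definition bar_cycle_group :: "nat \<Rightarrow> ('a, 'b) monoid_scheme \<Rightarrow> ('a list \<Rightarrow>\<^sub>0 int) monoid" where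
  "bar_cycle_group n G =
    subgroup_generated (bar_chain_group n G)
      {c \<in> carrier (bar_chain_group n G). bar_boundary n G c = 0}"

definition bar_boundaries :: "nat \<Rightarrow> ('a, 'b) monoid_scheme \<Rightarrow> ('a list \<Rightarrow>\<^sub>0 int) set" where
  "bar_boundaries n G = bar_boundary (Suc n) G ` carrier (bar_chain_group (Suc n) G)"

definition group_homology ::
    "nat \<Rightarrow> ('a, 'b) monoid_scheme \<Rightarrow> ('a list \<Rightarrow>\<^sub>0 int) set monoid" where
  "group_homology n G = bar_cycle_group n G Mod bar_boundaries n G"

definition bar_map :: "('a \<Rightarrow> 'c) \<Rightarrow> ('a list \<Rightarrow>\<^sub>0 int) \<Rightarrow> ('c list \<Rightarrow>\<^sub>0 int)" where
  "bar_map \<phi> = frag_extend (\<lambda>gs. frag_of (map \<phi> gs))"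

text \<open>The map \<open>\<phi>\<^sub>*\<close> into the homology of the target group \<open>H\<close> of a homomorphism \<open>\<phi>\<close>.\<close>

definition group_homology_map ::
    "nat \<Rightarrow> ('c, 'd) monoid_scheme \<Rightarrow> ('a \<Rightarrow> 'c) \<Rightarrow>
     ('a list \<Rightarrow>\<^sub>0 int) set \<Rightarrow> ('c list \<Rightarrow>\<^sub>0 int) set" where
  "group_homology_map n H \<phi> C =
    the_elem ((\<lambda>c. bar_boundaries n H #>\<^bsub>bar_cycle_group n H\<^esub> bar_map \<phi> c) ` C)"


section \<open>The Bogomolov multiplier\<close>

definition schur_multiplier :: "('a, 'b) monoid_scheme \<Rightarrow> ('a list \<Rightarrow>\<^sub>0 int) set monoid" where
  "schur_multiplier G = group_homology 2 G"

text \<open>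
  The torus is \<open>B(\<int> \<times> \<int>)\<close>, so its orientation classes are the generators of the infinite cyclic
  group \<open>H\<^sub>2(\<int> \<times> \<int>, \<int>)\<close>, and homotopy classes of maps from it to \<open>BG\<close> are induced by
  homomorphisms \<open>\<int> \<times> \<int> \<rightarrow> G\<close>.
\<close>

abbreviation integer_square :: "(int \<times> int) monoid" where
  "integer_square \<equiv> integer_group \<times>\<times> integer_group"

definition torus_orientation_class :: "((int \<times> int) list \<Rightarrow>\<^sub>0 int) set \<Rightarrow> bool" where
  "torus_orientation_class t \<longleftrightarrow>
    t \<in> carrier (group_homology 2 integer_square) \<and>
    generate (group_homology 2 integer_square) {t} = carrier (group_homology 2 integer_square)"

definition toral_classes :: "('a, 'b) monoid_scheme \<Rightarrow> ('a list \<Rightarrow>\<^sub>0 int) set set" where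
  "toral_classes G =
    {group_homology_map 2 G \<phi> t | \<phi> t. \<phi> \<in> hom integer_square G \<and> torus_orientation_class t}"

definition toral_subgroup :: "('a, 'b) monoid_scheme \<Rightarrow> ('a list \<Rightarrow>\<^sub>0 int) set set" where
  "toral_subgroup G = generate (schur_multiplier G) (toral_classes G)"

definition bogomolov_multiplier ::
    "('a, 'b) monoid_scheme \<Rightarrow> ('a list \<Rightarrow>\<^sub>0 int) set set monoid" where
  "bogomolov_multiplier G = schur_multiplier G Mod toral_subgroup G"

end

theory Submission
  imports Defs
begin

text \<open>
  Let \<open>S\<close> be the subgroup of \<open>H\<^sub>2(G)\<close> generated by the toral classes, and let \<open>N\<close> be the group of those
  bar \<open>2\<close>-cycles whose class lies in \<open>S\<close>. The claim \<open>S = H\<^sub>2(G)\<close> says that all \<open>2\<close>-cycles are in \<open>N\<close>.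
  Sending \<open>(g, h)\<close> to the class of the simplex \<open>[g|h]\<close> modulo \<open>N\<close> gives a \<open>2\<close>-cocycle, because \<open>N\<close> contains
  the boundaries, and hence a central extension \<open>E\<close> of \<open>G\<close>. If \<open>E\<close> splits, then the cocycle is a
  coboundary, so it vanishes on \<open>2\<close>-cycles, which is the claim. As coefficients one can take any abelian
  group that contains the \<open>2\<close>-chains modulo \<open>N\<close>; chains with rational coefficients modulo \<open>N\<close> are used,
  for there every element is divisible by two (\<open>second_homology_eqI\<close>).
  
  If \<open>g\<close> and \<open>h\<close> commute, then the class of \<open>[g|h] - [h|g]\<close> is toral (\<open>commutator_cycle_toral\<close>), so this
  cycle is in \<open>N\<close> and any lifts of \<open>g\<close> and \<open>h\<close> to \<open>E\<close> commute. Therefore a conjugate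
  \<open>w e w\<^sup>-\<^sup>1\<close> in \<open>E\<close> depends only on \<open>e\<close> and on the image of the conjugate in \<open>G\<close>, and lifting one element
  of each conjugacy class determines a section of sets \<open>\<sigma>\<close> that is equivariant under conjugation. By
  divisibility the lifts of involutions can be chosen to be involutions.
  
  For a Coxeter group the lifts \<open>\<sigma>(r\<^sub>i)\<close> of the generators satisfy the Coxeter relations
  (\<open>dihedral_relation_lift\<close>). Indeed, let \<open>m\<close> be the exponent in the relation between \<open>r\<^sub>i\<close> and \<open>r\<^sub>j\<close>, put
  \<open>k = m div 2\<close>, and conjugate by the rotation \<open>(r\<^sub>i r\<^sub>j)\<^sup>k\<close>. It fixes \<open>r\<^sub>i\<close> if \<open>m\<close> is even and takes \<open>r\<^sub>i\<close>
  to \<open>r\<^sub>j\<close> if \<open>m\<close> is odd. By equivariance the same holds for the lifts, and for two involutions \<open>s\<close> and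
  \<open>t\<close> of any group this amounts to \<open>(s t)\<^sup>m = 1\<close>. So \<open>E\<close> splits (\<open>coxeter_extension_splits\<close>).
  
  The torus itself is treated by the same criterion: the extension for \<open>\<int> \<times> \<int>\<close> in which the lifts
  of the two generators commute has an evident splitting, so the class of \<open>[a|b] - [b|a]\<close>
  generates \<open>H\<^sub>2(\<int> \<times> \<int>)\<close> and is an orientation class (\<open>torus_orientation_class_torus_cycle\<close>).
\<close>

section \<open>Extensions in which commuting elements lift to commuting elements\<close>

lemma (in group) involution_inv:
  assumes "x \<in> carrier G" "x \<otimes> x = \<one>"
  shows "inv x = x"
  using assms by (simp add: inv_equality)

lemma (in group) inv_mult_cancel:
  assumes "x \<in> carrier G" "y \<in> carrier G"
  shows "inv x \<otimes> (x \<otimes> y) = y" and "x \<otimes> (inv x \<otimes> y) = y"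
  using assms by (simp_all flip: m_assoc)

text \<open>
  Conjugation by \<open>s\<close> or by \<open>t\<close> turns \<open>s t\<close> into \<open>t s = (s t)\<^sup>-\<^sup>1\<close>.
\<close>

lemma (in group) dihedral_rotation_flip:
  assumes [simp]: "s \<in> carrier G" "t \<in> carrier G" and ss: "s \<otimes> s = \<one>" and tt: "t \<otimes> t = \<one>"
  shows "s \<otimes> (s \<otimes> t) [^] k \<otimes> s = inv ((s \<otimes> t) [^] (k::nat))"
    and "t \<otimes> (s \<otimes> t) [^] k \<otimes> t = inv ((s \<otimes> t) [^] k)"
proof -
  have flip: "u \<otimes> (s \<otimes> t) [^] k \<otimes> u = inv ((s \<otimes> t) [^] k)"
    if [simp]: "u \<in> carrier G" and uu: "u \<otimes> u = \<one>" and u: "u \<otimes> (s \<otimes> t) \<otimes> u = inv (s \<otimes> t)" for u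
  proof (induction k)
    case 0
    then show ?case by (simp add: uu)
  next
    case (Suc k)
    have "u \<otimes> (s \<otimes> t) [^] Suc k \<otimes> u = u \<otimes> (s \<otimes> t) [^] k \<otimes> \<one> \<otimes> (s \<otimes> t) \<otimes> u"
      by (simp add: m_assoc)
    also have "\<dots> = (u \<otimes> (s \<otimes> t) [^] k \<otimes> u) \<otimes> (u \<otimes> (s \<otimes> t) \<otimes> u)"
      by (simp add: m_assoc flip: uu)
    also have "\<dots> = inv ((s \<otimes> t) \<otimes> (s \<otimes> t) [^] k)"
      by (simp add: Suc u inv_mult_group m_assoc)
    also have "(s \<otimes> t) \<otimes> (s \<otimes> t) [^] k = (s \<otimes> t) [^] Suc k"
      by (rule nat_pow_Suc2 [symmetric]) simp
    finally show ?case .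
  qed
  have st: "inv (s \<otimes> t) = t \<otimes> s"
    by (simp add: inv_mult_group involution_inv ss tt)
  have "s \<otimes> (s \<otimes> t) \<otimes> s = (s \<otimes> s) \<otimes> (t \<otimes> s)" "t \<otimes> (s \<otimes> t) \<otimes> t = (t \<otimes> s) \<otimes> (t \<otimes> t)"
    by (simp_all add: m_assoc)
  then show "s \<otimes> (s \<otimes> t) [^] k \<otimes> s = inv ((s \<otimes> t) [^] k)"
    and "t \<otimes> (s \<otimes> t) [^] k \<otimes> t = inv ((s \<otimes> t) [^] k)"
    by (auto intro!: flip simp: ss tt st)
qed

text \<open>
  Both conditions hold for the extension built from the bar complex modulo toral classes: the first
  because commutator cycles of commuting pairs are killed, the second because the kernel is divisible
  by two. The first makes the kernel central, as a kernel element and any element have commuting images.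
\<close>

locale commuting_extension = group_hom E G \<pi>
  for E (structure) and G (structure) and \<pi> +
  assumes surj: "\<pi> ` carrier E = carrier G"
    and commuting_lift: "\<lbrakk>a \<in> carrier E; b \<in> carrier E; \<pi> a \<otimes>\<^bsub>G\<^esub> \<pi> b = \<pi> b \<otimes>\<^bsub>G\<^esub> \<pi> a\<rbrakk>
      \<Longrightarrow> a \<otimes>\<^bsub>E\<^esub> b = b \<otimes>\<^bsub>E\<^esub> a"
    and involution_lift: "\<lbrakk>x \<in> carrier G; x \<otimes>\<^bsub>G\<^esub> x = \<one>\<^bsub>G\<^esub>\<rbrakk>
      \<Longrightarrow> \<exists>e\<in>carrier E. \<pi> e = x \<and> e \<otimes>\<^bsub>E\<^esub> e = \<one>\<^bsub>E\<^esub>"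
begin

text \<open>
  The element \<open>b\<^sup>-\<^sup>1 a\<close> centralises \<open>e\<close> in the quotient, hence also upstairs.
\<close>

lemma conjugate_eqI:
  assumes [simp]: "a \<in> carrier E" "b \<in> carrier E" "e \<in> carrier E"
    and eq: "\<pi> a \<otimes>\<^bsub>G\<^esub> \<pi> e \<otimes>\<^bsub>G\<^esub> inv\<^bsub>G\<^esub> \<pi> a = \<pi> b \<otimes>\<^bsub>G\<^esub> \<pi> e \<otimes>\<^bsub>G\<^esub> inv\<^bsub>G\<^esub> \<pi> b"
  shows "a \<otimes>\<^bsub>E\<^esub> e \<otimes>\<^bsub>E\<^esub> inv\<^bsub>E\<^esub> a = b \<otimes>\<^bsub>E\<^esub> e \<otimes>\<^bsub>E\<^esub> inv\<^bsub>E\<^esub> b"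
proof -
  have "\<pi> a \<otimes>\<^bsub>G\<^esub> \<pi> e = \<pi> b \<otimes>\<^bsub>G\<^esub> \<pi> e \<otimes>\<^bsub>G\<^esub> inv\<^bsub>G\<^esub> \<pi> b \<otimes>\<^bsub>G\<^esub> \<pi> a"
    by (simp flip: eq add: H.m_assoc)
  then have "inv\<^bsub>G\<^esub> \<pi> b \<otimes>\<^bsub>G\<^esub> \<pi> a \<otimes>\<^bsub>G\<^esub> \<pi> e = \<pi> e \<otimes>\<^bsub>G\<^esub> (inv\<^bsub>G\<^esub> \<pi> b \<otimes>\<^bsub>G\<^esub> \<pi> a)"
    by (simp add: H.m_assoc H.inv_mult_cancel)
  then have "(inv\<^bsub>E\<^esub> b \<otimes>\<^bsub>E\<^esub> a) \<otimes>\<^bsub>E\<^esub> e = e \<otimes>\<^bsub>E\<^esub> (inv\<^bsub>E\<^esub> b \<otimes>\<^bsub>E\<^esub> a)"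
    by (intro commuting_lift) (simp_all)
  then have "b \<otimes>\<^bsub>E\<^esub> ((inv\<^bsub>E\<^esub> b \<otimes>\<^bsub>E\<^esub> a) \<otimes>\<^bsub>E\<^esub> e) \<otimes>\<^bsub>E\<^esub> inv\<^bsub>E\<^esub> a =
    b \<otimes>\<^bsub>E\<^esub> (e \<otimes>\<^bsub>E\<^esub> (inv\<^bsub>E\<^esub> b \<otimes>\<^bsub>E\<^esub> a)) \<otimes>\<^bsub>E\<^esub> inv\<^bsub>E\<^esub> a"
    by simp
  then show ?thesis
    by (simp add: G.m_assoc G.inv_mult_cancel)
qed

definition equivariant_lift :: "('c \<Rightarrow> 'a) \<Rightarrow> bool" where
  "equivariant_lift \<sigma> \<longleftrightarrow> (\<forall>x\<in>carrier G. \<sigma> x \<in> carrier E \<and> \<pi> (\<sigma> x) = x \<and>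
    (x \<otimes>\<^bsub>G\<^esub> x = \<one>\<^bsub>G\<^esub> \<longrightarrow> \<sigma> x \<otimes>\<^bsub>E\<^esub> \<sigma> x = \<one>\<^bsub>E\<^esub>) \<and>
    (\<forall>e\<in>carrier E. e \<otimes>\<^bsub>E\<^esub> \<sigma> x \<otimes>\<^bsub>E\<^esub> inv\<^bsub>E\<^esub> e = \<sigma> (\<pi> e \<otimes>\<^bsub>G\<^esub> x \<otimes>\<^bsub>G\<^esub> inv\<^bsub>G\<^esub> \<pi> e)))"

text \<open>
  Choose a lift of one representative of each conjugacy class and transport it by conjugation; the
  result does not depend on the conjugating element, by \<open>conjugate_eqI\<close>.
\<close>

lemma equivariant_lift_exists: "\<exists>\<sigma>. equivariant_lift \<sigma>"
proof -
  \<comment> \<open>The representative depends only on the set of conjugates of \<open>x\<close>, which is the same throughout a class.\<close>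
  define conj where "conj y x \<longleftrightarrow> y \<in> carrier G \<and>
    (\<exists>e\<in>carrier E. \<pi> e \<otimes>\<^bsub>G\<^esub> y \<otimes>\<^bsub>G\<^esub> inv\<^bsub>G\<^esub> (\<pi> e) = x)" for y x
  define rep where "rep x = (SOME y. conj y x)" for x
  have "\<exists>e\<in>carrier E. \<pi> e = y \<and> (y \<otimes>\<^bsub>G\<^esub> y = \<one>\<^bsub>G\<^esub> \<longrightarrow> e \<otimes>\<^bsub>E\<^esub> e = \<one>\<^bsub>E\<^esub>)" if "y \<in> carrier G" for y
    using involution_lift [OF that] surj that by (metis image_iff)
  then obtain \<tau> where \<tau>: "\<tau> y \<in> carrier E" "\<pi> (\<tau> y) = y"
      "y \<otimes>\<^bsub>G\<^esub> y = \<one>\<^bsub>G\<^esub> \<Longrightarrow> \<tau> y \<otimes>\<^bsub>E\<^esub> \<tau> y = \<one>\<^bsub>E\<^esub>" if "y \<in> carrier G" for y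
    by metis
  have conj_refl: "conj x x" if "x \<in> carrier G" for x
    unfolding conj_def using that by (auto intro!: bexI [of _ "\<one>\<^bsub>E\<^esub>"])
  have conj_rep: "conj (rep x) x" if "x \<in> carrier G" for x
    unfolding rep_def using conj_refl [OF that] by (rule someI)
  then obtain k where k: "k x \<in> carrier E"
      "\<pi> (k x) \<otimes>\<^bsub>G\<^esub> rep x \<otimes>\<^bsub>G\<^esub> inv\<^bsub>G\<^esub> (\<pi> (k x)) = x" "rep x \<in> carrier G" if "x \<in> carrier G" for x
    unfolding conj_def by metis
  \<comment> \<open>\<open>\<tau>\<close> lifts representatives, and \<open>k x\<close> conjugates the representative of the class to \<open>x\<close>.\<close>
  define \<sigma> where "\<sigma> x = k x \<otimes>\<^bsub>E\<^esub> \<tau> (rep x) \<otimes>\<^bsub>E\<^esub> inv\<^bsub>E\<^esub> (k x)" for x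
  have conj_iff: "conj y (\<pi> e \<otimes>\<^bsub>G\<^esub> x \<otimes>\<^bsub>G\<^esub> inv\<^bsub>G\<^esub> (\<pi> e)) \<longleftrightarrow> conj y x"
    if [simp]: "e \<in> carrier E" "x \<in> carrier G" for e x y
  proof -
    have *: "conj y (\<pi> e \<otimes>\<^bsub>G\<^esub> x \<otimes>\<^bsub>G\<^esub> inv\<^bsub>G\<^esub> (\<pi> e))" if "conj y x" and [simp]: "e \<in> carrier E" for e x
    proof -
      obtain d where [simp]: "d \<in> carrier E" "y \<in> carrier G"
        and x: "x = \<pi> d \<otimes>\<^bsub>G\<^esub> y \<otimes>\<^bsub>G\<^esub> inv\<^bsub>G\<^esub> (\<pi> d)"
        using \<open>conj y x\<close> unfolding conj_def by auto
      show ?thesis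
        unfolding conj_def x by (auto intro!: bexI [of _ "e \<otimes>\<^bsub>E\<^esub> d"] simp: H.inv_mult_group H.m_assoc)
    qed
    have "\<pi> (inv\<^bsub>E\<^esub> e) \<otimes>\<^bsub>G\<^esub> (\<pi> e \<otimes>\<^bsub>G\<^esub> x \<otimes>\<^bsub>G\<^esub> inv\<^bsub>G\<^esub> (\<pi> e)) \<otimes>\<^bsub>G\<^esub> inv\<^bsub>G\<^esub> (\<pi> (inv\<^bsub>E\<^esub> e)) = x"
      by (simp add: H.m_assoc H.inv_mult_cancel)
    then show ?thesis
      using * [of x e] * [of "\<pi> e \<otimes>\<^bsub>G\<^esub> x \<otimes>\<^bsub>G\<^esub> inv\<^bsub>G\<^esub> (\<pi> e)" "inv\<^bsub>E\<^esub> e"] by auto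
  qed
  have "equivariant_lift \<sigma>"
    unfolding equivariant_lift_def
  proof (intro ballI conjI impI)
    fix x assume x [simp]: "x \<in> carrier G"
    note [simp] = \<tau> k
    show "\<sigma> x \<in> carrier E" "\<pi> (\<sigma> x) = x"
      by (simp_all add: \<sigma>_def)
    show "\<sigma> x \<otimes>\<^bsub>E\<^esub> \<sigma> x = \<one>\<^bsub>E\<^esub>" if "x \<otimes>\<^bsub>G\<^esub> x = \<one>\<^bsub>G\<^esub>"
    proof -
      have "rep x = inv\<^bsub>G\<^esub> (\<pi> (k x)) \<otimes>\<^bsub>G\<^esub> x \<otimes>\<^bsub>G\<^esub> \<pi> (k x)"
        by (subst (3) k(2) [OF x, symmetric]) (simp add: H.m_assoc H.inv_mult_cancel)
      then have "rep x \<otimes>\<^bsub>G\<^esub> rep x = inv\<^bsub>G\<^esub> (\<pi> (k x)) \<otimes>\<^bsub>G\<^esub> (x \<otimes>\<^bsub>G\<^esub> x) \<otimes>\<^bsub>G\<^esub> \<pi> (k x)"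
        by (simp add: H.m_assoc H.inv_mult_cancel)
      then have "\<tau> (rep x) \<otimes>\<^bsub>E\<^esub> \<tau> (rep x) = \<one>\<^bsub>E\<^esub>"
        by (simp add: that)
      moreover have "\<sigma> x \<otimes>\<^bsub>E\<^esub> \<sigma> x = k x \<otimes>\<^bsub>E\<^esub> (\<tau> (rep x) \<otimes>\<^bsub>E\<^esub> \<tau> (rep x)) \<otimes>\<^bsub>E\<^esub> inv\<^bsub>E\<^esub> (k x)"
        by (simp add: \<sigma>_def G.m_assoc G.inv_mult_cancel)
      ultimately show ?thesis by simp
    qed
    show "e \<otimes>\<^bsub>E\<^esub> \<sigma> x \<otimes>\<^bsub>E\<^esub> inv\<^bsub>E\<^esub> e = \<sigma> (\<pi> e \<otimes>\<^bsub>G\<^esub> x \<otimes>\<^bsub>G\<^esub> inv\<^bsub>G\<^esub> (\<pi> e))"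
      if e [simp]: "e \<in> carrier E" for e
    proof -
      let ?y = "\<pi> e \<otimes>\<^bsub>G\<^esub> x \<otimes>\<^bsub>G\<^esub> inv\<^bsub>G\<^esub> (\<pi> e)"
      have y [simp]: "?y \<in> carrier G" by simp
      have rep: "rep ?y = rep x"
        by (simp add: rep_def conj_iff)
      have ky: "\<pi> (k ?y) \<otimes>\<^bsub>G\<^esub> rep x \<otimes>\<^bsub>G\<^esub> inv\<^bsub>G\<^esub> (\<pi> (k ?y)) = ?y"
        using k(2) [OF y] rep by simp
      have "e \<otimes>\<^bsub>E\<^esub> \<sigma> x \<otimes>\<^bsub>E\<^esub> inv\<^bsub>E\<^esub> e =
        (e \<otimes>\<^bsub>E\<^esub> k x) \<otimes>\<^bsub>E\<^esub> \<tau> (rep x) \<otimes>\<^bsub>E\<^esub> inv\<^bsub>E\<^esub> (e \<otimes>\<^bsub>E\<^esub> k x)"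
        by (simp add: \<sigma>_def G.m_assoc G.inv_mult_group)
      also have "\<dots> = k ?y \<otimes>\<^bsub>E\<^esub> \<tau> (rep x) \<otimes>\<^bsub>E\<^esub> inv\<^bsub>E\<^esub> (k ?y)"
      proof (rule conjugate_eqI)
        have "\<pi> (e \<otimes>\<^bsub>E\<^esub> k x) \<otimes>\<^bsub>G\<^esub> rep x \<otimes>\<^bsub>G\<^esub> inv\<^bsub>G\<^esub> \<pi> (e \<otimes>\<^bsub>E\<^esub> k x) =
          \<pi> e \<otimes>\<^bsub>G\<^esub> (\<pi> (k x) \<otimes>\<^bsub>G\<^esub> rep x \<otimes>\<^bsub>G\<^esub> inv\<^bsub>G\<^esub> (\<pi> (k x))) \<otimes>\<^bsub>G\<^esub> inv\<^bsub>G\<^esub> (\<pi> e)"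
          by (simp add: H.m_assoc H.inv_mult_group del: k(2))
        then show "\<pi> (e \<otimes>\<^bsub>E\<^esub> k x) \<otimes>\<^bsub>G\<^esub> \<pi> (\<tau> (rep x)) \<otimes>\<^bsub>G\<^esub> inv\<^bsub>G\<^esub> \<pi> (e \<otimes>\<^bsub>E\<^esub> k x) =
          \<pi> (k ?y) \<otimes>\<^bsub>G\<^esub> \<pi> (\<tau> (rep x)) \<otimes>\<^bsub>G\<^esub> inv\<^bsub>G\<^esub> \<pi> (k ?y)"
          unfolding \<tau>(2)[OF k(3)[OF x]] ky k(2)[OF x] .
      qed (use k(1)[OF y] in simp_all)
      also have "\<dots> = \<sigma> ?y"
        by (simp add: \<sigma>_def rep)
      finally show ?thesis .
    qed
  qed
  then show ?thesis by blast
qed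

text \<open>
  In a group generated by involutions \<open>x\<close> and \<open>y\<close>, the relation \<open>(x y)\<^sup>m = 1\<close> can be restated through the
  conjugation action of the rotation \<open>p = (x y)\<^sup>k\<close> with \<open>k = m div 2\<close>: for even \<open>m\<close> it says \<open>p x = x p\<close>,
  and for odd \<open>m\<close> it says \<open>p x = y p\<close>. In this form the relation is preserved by an equivariant lift.
\<close>

lemma dihedral_relation_lift:
  assumes \<sigma>_lift: "equivariant_lift \<sigma>"
    and xy [simp]: "x \<in> carrier G" "y \<in> carrier G"
    and xx: "x \<otimes>\<^bsub>G\<^esub> x = \<one>\<^bsub>G\<^esub>" and yy: "y \<otimes>\<^bsub>G\<^esub> y = \<one>\<^bsub>G\<^esub>"
    and rel: "(x \<otimes>\<^bsub>G\<^esub> y) [^]\<^bsub>G\<^esub> (m::nat) = \<one>\<^bsub>G\<^esub>"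
  shows "(\<sigma> x \<otimes>\<^bsub>E\<^esub> \<sigma> y) [^]\<^bsub>E\<^esub> m = \<one>\<^bsub>E\<^esub>"
proof -
  have \<sigma>: "\<sigma> x \<in> carrier E" "\<pi> (\<sigma> x) = x"
    "x \<otimes>\<^bsub>G\<^esub> x = \<one>\<^bsub>G\<^esub> \<Longrightarrow> \<sigma> x \<otimes>\<^bsub>E\<^esub> \<sigma> x = \<one>\<^bsub>E\<^esub>"
    "\<And>e. e \<in> carrier E \<Longrightarrow> e \<otimes>\<^bsub>E\<^esub> \<sigma> x \<otimes>\<^bsub>E\<^esub> inv\<^bsub>E\<^esub> e = \<sigma> (\<pi> e \<otimes>\<^bsub>G\<^esub> x \<otimes>\<^bsub>G\<^esub> inv\<^bsub>G\<^esub> \<pi> e)"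
    if "x \<in> carrier G" for x
    using \<sigma>_lift that by (auto simp: equivariant_lift_def)
  define k where "k = m div 2"
  define p where "p = (x \<otimes>\<^bsub>G\<^esub> y) [^]\<^bsub>G\<^esub> k"
  define P where "P = (\<sigma> x \<otimes>\<^bsub>E\<^esub> \<sigma> y) [^]\<^bsub>E\<^esub> k"
  note [simp] = \<sigma>(1,2)
  have [simp]: "p \<in> carrier G" "P \<in> carrier E" and \<pi>P: "\<pi> P = p"
    by (simp_all add: p_def P_def hom_nat_pow)
  note flip_G = H.dihedral_rotation_flip [OF xy xx yy, of k, folded p_def]
  note flip_E = G.dihedral_rotation_flip [OF \<sigma>(1) [OF xy(1)] \<sigma>(1) [OF xy(2)]
      \<sigma>(3) [OF xy(1) xx] \<sigma>(3) [OF xy(2) yy], of k, folded P_def]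
  show ?thesis
  proof (cases "even m")
    case True
    then have m: "m = k + k" by (auto simp: k_def)
    have pp: "p \<otimes>\<^bsub>G\<^esub> p = \<one>\<^bsub>G\<^esub>"
      using rel by (simp add: p_def m H.nat_pow_mult)
    have "p \<otimes>\<^bsub>G\<^esub> x \<otimes>\<^bsub>G\<^esub> inv\<^bsub>G\<^esub> p = x"
    proof -
      have "x \<otimes>\<^bsub>G\<^esub> (p \<otimes>\<^bsub>G\<^esub> x) = inv\<^bsub>G\<^esub> p" using flip_G(1) by (simp add: H.m_assoc)
      then have "p \<otimes>\<^bsub>G\<^esub> x = inv\<^bsub>G\<^esub> x \<otimes>\<^bsub>G\<^esub> inv\<^bsub>G\<^esub> p"
        by (metis H.inv_solve_left' H.m_closed H.inv_closed \<open>p \<in> carrier G\<close> xy(1))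
      then show ?thesis
        by (simp add: H.involution_inv xx pp H.m_assoc)
    qed
    then have "P \<otimes>\<^bsub>E\<^esub> \<sigma> x \<otimes>\<^bsub>E\<^esub> inv\<^bsub>E\<^esub> P = \<sigma> x"
      using \<sigma>(4) [of x P] by (simp add: \<pi>P)
    then have "P \<otimes>\<^bsub>E\<^esub> \<sigma> x = \<sigma> x \<otimes>\<^bsub>E\<^esub> P"
      by (metis G.inv_solve_right' G.m_closed \<open>P \<in> carrier E\<close> \<sigma>(1) xy(1))
    then have "inv\<^bsub>E\<^esub> P = \<sigma> x \<otimes>\<^bsub>E\<^esub> \<sigma> x \<otimes>\<^bsub>E\<^esub> P"
      using flip_E(1) by (simp add: G.m_assoc)
    then have "P \<otimes>\<^bsub>E\<^esub> P = \<one>\<^bsub>E\<^esub>"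
      by (metis G.l_one G.r_inv \<open>P \<in> carrier E\<close> \<sigma>(3) xx xy(1))
    then show ?thesis
      by (simp add: m P_def G.nat_pow_mult)
  next
    case False
    then have m: "m = Suc (k + k)" by (auto simp: k_def elim: oddE)
    have "p \<otimes>\<^bsub>G\<^esub> p \<otimes>\<^bsub>G\<^esub> (x \<otimes>\<^bsub>G\<^esub> y) = \<one>\<^bsub>G\<^esub>"
      using rel by (simp add: p_def m flip: H.nat_pow_mult)
    then have "p \<otimes>\<^bsub>G\<^esub> x \<otimes>\<^bsub>G\<^esub> y = inv\<^bsub>G\<^esub> p"
      by (metis H.inv_equality H.inv_inv H.m_assoc H.m_closed H.inv_closed \<open>p \<in> carrier G\<close> xy)
    also have "\<dots> = y \<otimes>\<^bsub>G\<^esub> p \<otimes>\<^bsub>G\<^esub> y"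
      using flip_G(2) by simp
    finally have "p \<otimes>\<^bsub>G\<^esub> x = y \<otimes>\<^bsub>G\<^esub> p"
      by (metis H.m_closed H.right_cancel \<open>p \<in> carrier G\<close> xy)
    then have "p \<otimes>\<^bsub>G\<^esub> x \<otimes>\<^bsub>G\<^esub> inv\<^bsub>G\<^esub> p = y"
      by (simp add: H.m_assoc)
    then have "P \<otimes>\<^bsub>E\<^esub> \<sigma> x \<otimes>\<^bsub>E\<^esub> inv\<^bsub>E\<^esub> P = \<sigma> y"
      using \<sigma>(4) [of x P] by (simp add: \<pi>P)
    then have "P \<otimes>\<^bsub>E\<^esub> \<sigma> x = \<sigma> y \<otimes>\<^bsub>E\<^esub> P"
      by (metis G.inv_solve_right' G.m_closed \<open>P \<in> carrier E\<close> \<sigma>(1) xy)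
    then have "P \<otimes>\<^bsub>E\<^esub> (P \<otimes>\<^bsub>E\<^esub> \<sigma> x \<otimes>\<^bsub>E\<^esub> \<sigma> y) = \<one>\<^bsub>E\<^esub>"
      using flip_E(2) by simp
    then show ?thesis
      by (simp add: m P_def G.m_assoc flip: G.nat_pow_mult)
  qed
qed

end

section \<open>Homomorphisms out of a presented group\<close>

definition word_eval :: "('a, 'b) monoid_scheme \<Rightarrow> ('x \<Rightarrow> 'a) \<Rightarrow> 'x word \<Rightarrow> 'a" where
  "word_eval K s w =
    foldr (\<lambda>(x, b) a. (if b then s x else inv\<^bsub>K\<^esub> s x) \<otimes>\<^bsub>K\<^esub> a) w \<one>\<^bsub>K\<^esub>"

lemma word_eval_simps [simp]:
  "word_eval K s [] = \<one>\<^bsub>K\<^esub>"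
  "word_eval K s ((x, b) # w) = (if b then s x else inv\<^bsub>K\<^esub> s x) \<otimes>\<^bsub>K\<^esub> word_eval K s w"
  by (simp_all add: word_eval_def)

lemma words_simps [simp]:
  "[] \<in> words X"
  "(x, b) # w \<in> words X \<longleftrightarrow> x \<in> X \<and> w \<in> words X"
  "u @ v \<in> words X \<longleftrightarrow> u \<in> words X \<and> v \<in> words X"
  by (auto simp: words_def)

lemma (in group) word_eval_closed:
  assumes "s ` X \<subseteq> carrier G" "w \<in> words X"
  shows "word_eval G s w \<in> carrier G"
  using assms(2)
proof (induction w)
  case (Cons l w)
  then show ?case using assms(1) by (cases l) auto
qed simp

lemma (in group) word_eval_append:
  assumes "s ` X \<subseteq> carrier G" "u \<in> words X" "v \<in> words X"
  shows "word_eval G s (u @ v) = word_eval G s u \<otimes> word_eval G s v"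
  using assms(2)
proof (induction u)
  case Nil
  then show ?case using word_eval_closed [OF assms(1,3)] by simp
next
  case (Cons l u)
  then show ?case
    using assms(1) word_eval_closed [OF assms(1)] assms(3) by (cases l) (auto simp: m_assoc)
qed

lemma (in group) word_eval_power_relator:
  assumes "s i \<in> carrier G" "s j \<in> carrier G"
  shows "word_eval G s (concat (replicate m [(i, True), (j, True)])) = (s i \<otimes> s j) [^] m"
proof (induction m)
  case (Suc m)
  have "word_eval G s (concat (replicate (Suc m) [(i, True), (j, True)])) = (s i \<otimes> s j) \<otimes> (s i \<otimes> s j) [^] m"
    using assms by (simp add: Suc m_assoc)
  also have "\<dots> = (s i \<otimes> s j) [^] Suc m"
    using assms by (intro nat_pow_Suc2 [symmetric]) simp
  finally show ?case .
qed simp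

lemma (in group) word_eval_pres_equiv:
  assumes s: "s ` X \<subseteq> carrier G" and R: "\<forall>w\<in>R \<inter> words X. word_eval G s w = \<one>"
    and "pres_equiv X R u v"
  shows "word_eval G s u = word_eval G s v"
  using assms(3)
proof induction
  case (cancel u v x b)
  note [simp] = word_eval_append [OF s] word_eval_closed [OF s]
  have "s x \<in> carrier G" using s cancel by auto
  then have "word_eval G s [(x, b), (x, \<not> b)] = \<one>" by simp
  moreover have "[(x, b), (x, \<not> b)] \<in> words X" using cancel by simp
  ultimately show ?case
    using cancel
    by (simp del: word_eval_simps append_Cons)
next
  case (relator u v w)
  note [simp] = word_eval_append [OF s] word_eval_closed [OF s]
  from relator R show ?case by simp
next
  case (trans u v w)
  show ?case using trans.IH by (rule HOL.trans)
qed simp_all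

lemma pres_equiv_words:
  assumes "pres_equiv X R u v"
  shows "u \<in> words X" "v \<in> words X"
  using assms by (induction) simp_all

lemma pres_equiv_append_left:
  assumes "pres_equiv X R u v" "w \<in> words X"
  shows "pres_equiv X R (w @ u) (w @ v)"
  using assms
proof induction
  case (cancel u v x b)
  then show ?case using pres_equiv.cancel [of "w @ u" X v x R b] by simp
next
  case (relator u v r)
  then have "pres_equiv X R ((w @ u) @ r @ v) ((w @ u) @ v)"
    by (intro pres_equiv.relator) simp_all
  then show ?case by simp
next
  case (refl u)
  then show ?case by (intro pres_equiv.refl) simp
next
  case (sym u v)
  show ?case by (rule pres_equiv.sym [OF sym.IH [OF sym.prems]])
next
  case (trans u v x)
  show ?case by (rule pres_equiv.trans [OF trans.IH(1) [OF trans.prems] trans.IH(2) [OF trans.prems]])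
qed

lemma pres_equiv_append_right:
  assumes "pres_equiv X R u v" "w \<in> words X"
  shows "pres_equiv X R (u @ w) (v @ w)"
  using assms
proof induction
  case (cancel u v x b)
  then show ?case using pres_equiv.cancel [of u X "v @ w" x R b] by simp
next
  case (relator u v r)
  then show ?case using pres_equiv.relator [of u X "v @ w" r R] by simp
next
  case (refl u)
  then show ?case by (intro pres_equiv.refl) simp
next
  case (sym u v)
  show ?case by (rule pres_equiv.sym [OF sym.IH [OF sym.prems]])
next
  case (trans u v x)
  show ?case by (rule pres_equiv.trans [OF trans.IH(1) [OF trans.prems] trans.IH(2) [OF trans.prems]])
qed

lemma pres_class_eqI:
  assumes uv: "pres_equiv X R u v"
  shows "pres_class X R u = pres_class X R v"
proof -
  have "pres_equiv X R u w \<longleftrightarrow> pres_equiv X R v w" for w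
    using pres_equiv.trans [OF uv, of w] pres_equiv.trans [OF pres_equiv.sym [OF uv], of w] by iprover
  then show ?thesis
    by (simp add: pres_class_def)
qed

lemma presented_group_mult:
  assumes "u \<in> words X" "v \<in> words X"
  shows "pres_class X R u \<otimes>\<^bsub>presented_group X R\<^esub> pres_class X R v = pres_class X R (u @ v)"
proof -
  have "pres_class X R (u' @ v') = pres_class X R (u @ v)"
    if "u' \<in> pres_class X R u" "v' \<in> pres_class X R v" for u' v'
  proof -
    have "pres_equiv X R (u @ v) (u' @ v)" "pres_equiv X R (u' @ v) (u' @ v')"
      using that assms unfolding pres_class_def
      by (auto intro: pres_equiv_append_left pres_equiv_append_right dest: pres_equiv_words)
    then show ?thesis
      by (simp add: pres_class_eqI)
  qed
  then have "(\<Union>u'\<in>pres_class X R u. \<Union>v'\<in>pres_class X R v. pres_class X R (u' @ v')) =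
      (\<Union>u'\<in>pres_class X R u. \<Union>v'\<in>pres_class X R v. pres_class X R (u @ v))"
    by simp
  moreover have "u \<in> pres_class X R u" "v \<in> pres_class X R v"
    using assms by (simp_all add: pres_class_def pres_equiv.refl)
  then have "pres_class X R u \<noteq> {}" "pres_class X R v \<noteq> {}"
    by blast+
  ultimately show ?thesis
    by (simp add: presented_group_def)
qed

lemma pres_class_in_carrier: "w \<in> words X \<Longrightarrow> pres_class X R w \<in> carrier (presented_group X R)"
  by (simp add: presented_group_def)

lemma presented_group_hom_eq_word_eval:
  assumes "group K" and f: "f \<in> hom (presented_group X R) K" and "w \<in> words X"
  shows "f (pres_class X R w) = word_eval K (\<lambda>x. f (pres_class X R [(x, True)])) w"
proof -
  interpret K: group K by fact
  have closed: "f (pres_class X R w) \<in> carrier K" if "w \<in> words X" for w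
    using f that by (auto simp: hom_def intro: pres_class_in_carrier)
  have mult: "f (pres_class X R (u @ v)) = f (pres_class X R u) \<otimes>\<^bsub>K\<^esub> f (pres_class X R v)"
    if "u \<in> words X" "v \<in> words X" for u v
    using f that by (simp add: hom_mult pres_class_in_carrier flip: presented_group_mult)
  have Nil: "f (pres_class X R []) = \<one>\<^bsub>K\<^esub>"
    using mult [of "[]" "[]"] closed [of "[]"] by (simp add: K.l_cancel_one')
  show ?thesis
    using assms(3)
  proof (induction w)
    case Nil
    then show ?case by (simp add: \<open>f (pres_class X R []) = \<one>\<^bsub>K\<^esub>\<close>)
  next
    case (Cons l w)
    obtain x b where l: "l = (x, b)" by force
    then have x: "x \<in> X" and w: "w \<in> words X" using Cons.prems by auto
    have "f (pres_class X R [(x, False)]) \<otimes>\<^bsub>K\<^esub> f (pres_class X R [(x, True)]) =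
        f (pres_class X R [(x, False), (x, True)])"
      using mult [of "[(x, False)]" "[(x, True)]"] x by simp
    also have "\<dots> = \<one>\<^bsub>K\<^esub>"
      using pres_equiv.cancel [of "[]" X "[]" x R False] x Nil
      by (metis append.left_neutral append.right_neutral pres_class_eqI words_simps(1))
    finally have "f (pres_class X R [(x, False)]) = inv\<^bsub>K\<^esub> f (pres_class X R [(x, True)])"
      using x by (simp add: K.inv_equality closed)
    then have "f (pres_class X R [(x, b)]) =
        (if b then f (pres_class X R [(x, True)]) else inv\<^bsub>K\<^esub> f (pres_class X R [(x, True)]))"
      by (cases b) auto
    then show ?case
      using mult [of "[(x, b)]" w] x w Cons.IH by (simp add: l)
  qed
qed

text \<open>
  Von Dyck's theorem.
\<close>

lemma (in group) presented_group_universal: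
  assumes s: "s ` X \<subseteq> carrier G" and R: "\<forall>w\<in>R \<inter> words X. word_eval G s w = \<one>"
  obtains f where "f \<in> hom (presented_group X R) G"
    and "\<And>w. w \<in> words X \<Longrightarrow> f (pres_class X R w) = word_eval G s w"
proof -
  define f where "f C = word_eval G s (SOME v. v \<in> C)" for C
  have f: "f (pres_class X R w) = word_eval G s w" if "w \<in> words X" for w
  proof -
    have "w \<in> pres_class X R w"
      using that by (simp add: pres_class_def pres_equiv.refl)
    then have "(SOME v. v \<in> pres_class X R w) \<in> pres_class X R w"
      by (rule someI)
    then have "pres_equiv X R w (SOME v. v \<in> pres_class X R w)"
      by (simp add: pres_class_def)
    then show ?thesis
      unfolding f_def by (rule word_eval_pres_equiv [OF s R, symmetric])
  qed
  have "f \<in> hom (presented_group X R) G"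
  proof (rule homI)
    fix C assume "C \<in> carrier (presented_group X R)"
    then show "f C \<in> carrier G"
      by (auto simp: presented_group_def f word_eval_closed [OF s])
  next
    fix C D assume "C \<in> carrier (presented_group X R)" "D \<in> carrier (presented_group X R)"
    then obtain u v where uv: "u \<in> words X" "v \<in> words X"
      and [simp]: "C = pres_class X R u" "D = pres_class X R v"
      by (auto simp: presented_group_def)
    then show "f (C \<otimes>\<^bsub>presented_group X R\<^esub> D) = f C \<otimes> f D"
      by (simp add: presented_group_mult f word_eval_append [OF s])
  qed
  then show thesis
    using f by (rule that)
qed

text \<open>
  The equivariant lift need not be a homomorphism, but its values on the Coxeter generators satisfy the
  Coxeter relations, so von Dyck's theorem extends them to one. Composing this homomorphism with the
  projection gives the identity, since it does so on generators.
\<close>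

proposition coxeter_extension_splits:
  assumes "commuting_extension E G \<pi>" and "coxeter_matrix n m"
    and "G \<cong> presented_group {1..n} (coxeter_relators n m)"
  shows "\<exists>\<sigma>\<in>hom G E. \<forall>x\<in>carrier G. \<pi> (\<sigma> x) = x"
proof -
  interpret commuting_extension E G \<pi> by fact
  let ?P = "presented_group {1..n} (coxeter_relators n m)"
  let ?cl = "pres_class {1..n} (coxeter_relators n m)"
  obtain h where h: "h \<in> hom G ?P" "bij_betw h (carrier G) (carrier ?P)"
    using assms(3) by (auto simp: is_iso_def iso_def)
  define k where "k = inv_into (carrier G) h"
  have k: "k \<in> hom ?P G"
    using H.iso_set_sym [of h ?P] h by (auto simp: iso_def k_def)
  have kh: "k (h x) = x" if "x \<in> carrier G" for x
    using h(2) that by (simp add: k_def bij_betw_inv_into_left)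
  define r where "r i = k (?cl [(i, True)])" for i
  have r_closed: "r i \<in> carrier G" if "i \<in> {1..n}" for i
    using k that by (auto simp: r_def hom_def intro!: pres_class_in_carrier)
  have k_word: "k (?cl w) = word_eval G r w" if "w \<in> words {1..n}" for w
    using presented_group_hom_eq_word_eval [OF _ k that] by (simp add: r_def [abs_def])
  have relation: "(r i \<otimes>\<^bsub>G\<^esub> r j) [^]\<^bsub>G\<^esub> m i j = \<one>\<^bsub>G\<^esub>" if ij: "i \<in> {1..n}" "j \<in> {1..n}" for i j
  proof -
    let ?w = "concat (replicate (m i j) [(i, True), (j, True)])"
    have w: "?w \<in> words {1..n}"
      using ij by (induction ("m i j")) simp_all
    have "?w \<in> coxeter_relators n m"
      using ij by (auto simp: coxeter_relators_def)
    then have "?cl ?w = ?cl []"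
      using pres_equiv.relator [of "[]" "{1..n}" "[]" ?w "coxeter_relators n m"] w
      by (intro pres_class_eqI) simp
    then have "word_eval G r ?w = word_eval G r []"
      using k_word [OF w] k_word [of "[]"] by simp
    then show ?thesis
      using H.word_eval_power_relator [of r i j] r_closed ij by simp
  qed
  have square: "r i \<otimes>\<^bsub>G\<^esub> r i = \<one>\<^bsub>G\<^esub>" if "i \<in> {1..n}" for i
    using relation [OF that that] assms(2) that r_closed [OF that] by (simp add: coxeter_matrix_def)
  obtain \<sigma> where lift: "equivariant_lift \<sigma>"
    using equivariant_lift_exists by blast
  then have \<sigma>: "\<sigma> x \<in> carrier E" "\<pi> (\<sigma> x) = x" if "x \<in> carrier G" for x
    using that by (auto simp: equivariant_lift_def)
  have s: "(\<sigma> \<circ> r) ` {1..n} \<subseteq> carrier E"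
    using \<sigma>(1) r_closed by auto
  have "word_eval E (\<sigma> \<circ> r) w = \<one>\<^bsub>E\<^esub>" if "w \<in> coxeter_relators n m" for w
  proof -
    obtain i j where w: "w = concat (replicate (m i j) [(i, True), (j, True)])"
      and ij: "i \<in> {1..n}" "j \<in> {1..n}"
      using \<open>w \<in> coxeter_relators n m\<close> by (auto simp: coxeter_relators_def)
    have "(\<sigma> (r i) \<otimes>\<^bsub>E\<^esub> \<sigma> (r j)) [^]\<^bsub>E\<^esub> m i j = \<one>\<^bsub>E\<^esub>"
      by (rule dihedral_relation_lift [OF lift]) (use ij in \<open>simp_all add: r_closed square relation\<close>)
    then show ?thesis
      using ij by (simp add: w G.word_eval_power_relator \<sigma>(1) r_closed)
  qed
  then obtain f where f: "f \<in> hom ?P E"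
    and f_word: "\<And>w. w \<in> words {1..n} \<Longrightarrow> f (?cl w) = word_eval E (\<sigma> \<circ> r) w"
    using G.presented_group_universal [OF s] by (metis IntD1)
  have "\<pi> \<circ> f \<in> hom ?P G"
    using Group.hom_compose [OF f homh] .
  have "\<pi> (f C) = k C" if C_in: "C \<in> carrier ?P" for C
  proof -
    obtain w where C: "C = ?cl w" and w: "w \<in> words {1..n}"
      using C_in by (auto simp: presented_group_def)
    have eval_cong: "word_eval G r' w = word_eval G r w" if "\<And>i. i \<in> {1..n} \<Longrightarrow> r' i = r i" for r'
      using w that by (induction w) auto
    have gen: "(\<pi> \<circ> f) (?cl [(i, True)]) = r i" if "i \<in> {1..n}" for i
      using that f_word [of "[(i, True)]"] \<sigma> r_closed [OF that] by simp
    have "(\<pi> \<circ> f) (?cl w) = word_eval G r w"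
      using presented_group_hom_eq_word_eval [OF _ \<open>\<pi> \<circ> f \<in> hom ?P G\<close> w] eval_cong [OF gen] by simp
    then show ?thesis
      using k_word [OF w] by (simp add: C)
  qed
  then have "\<pi> ((f \<circ> h) x) = x" if "x \<in> carrier G" for x
    using h(1) that kh by (simp add: hom_in_carrier)
  then show ?thesis
    using Group.hom_compose [OF h(1) f] by blast
qed

section \<open>Central extensions defined by cocycles\<close>

text \<open>
  The bar complex is not normalised, so \<open>f 1 1\<close> need not be trivial and enters the neutral element.
\<close>

definition cocycle_extension ::
    "('d, 'e) monoid_scheme \<Rightarrow> ('a, 'b) monoid_scheme \<Rightarrow> ('a \<Rightarrow> 'a \<Rightarrow> 'd) \<Rightarrow> ('d \<times> 'a) monoid" where
  "cocycle_extension D G f =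
    \<lparr>carrier = carrier D \<times> carrier G,
     monoid.mult = (\<lambda>(a, g) (b, h). (a \<otimes>\<^bsub>D\<^esub> b \<otimes>\<^bsub>D\<^esub> f g h, g \<otimes>\<^bsub>G\<^esub> h)),
     one = (inv\<^bsub>D\<^esub> f \<one>\<^bsub>G\<^esub> \<one>\<^bsub>G\<^esub>, \<one>\<^bsub>G\<^esub>)\<rparr>"

locale cocycle = D: comm_group D + G: group G
  for D (structure) and G (structure) +
  fixes f
  assumes f_closed [simp]: "\<lbrakk>g \<in> carrier G; h \<in> carrier G\<rbrakk> \<Longrightarrow> f g h \<in> carrier D"
    and cocycle: "\<lbrakk>g \<in> carrier G; h \<in> carrier G; k \<in> carrier G\<rbrakk>
      \<Longrightarrow> f g h \<otimes>\<^bsub>D\<^esub> f (g \<otimes>\<^bsub>G\<^esub> h) k = f h k \<otimes>\<^bsub>D\<^esub> f g (h \<otimes>\<^bsub>G\<^esub> k)"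
begin

abbreviation E where "E \<equiv> cocycle_extension D G f"

lemma extension_simps [simp]:
  "carrier E = carrier D \<times> carrier G"
  "(a, g) \<otimes>\<^bsub>E\<^esub> (b, h) = (a \<otimes>\<^bsub>D\<^esub> b \<otimes>\<^bsub>D\<^esub> f g h, g \<otimes>\<^bsub>G\<^esub> h)"
  "\<one>\<^bsub>E\<^esub> = (inv\<^bsub>D\<^esub> f \<one>\<^bsub>G\<^esub> \<one>\<^bsub>G\<^esub>, \<one>\<^bsub>G\<^esub>)"
  by (simp_all add: cocycle_extension_def)

lemma cocycle_one_left:
  assumes "g \<in> carrier G"
  shows "f \<one>\<^bsub>G\<^esub> g = f \<one>\<^bsub>G\<^esub> \<one>\<^bsub>G\<^esub>"
  using cocycle [of "\<one>\<^bsub>G\<^esub>" "\<one>\<^bsub>G\<^esub>" g] assms by simp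

lemma group_extension: "group E"
proof (rule groupI)
  fix x y z
  assume "x \<in> carrier E" "y \<in> carrier E" "z \<in> carrier E"
  then obtain a g b h c k where [simp]: "x = (a, g)" "y = (b, h)" "z = (c, k)"
    "a \<in> carrier D" "b \<in> carrier D" "c \<in> carrier D" "g \<in> carrier G" "h \<in> carrier G" "k \<in> carrier G"
    by auto
  have "a \<otimes>\<^bsub>D\<^esub> b \<otimes>\<^bsub>D\<^esub> f g h \<otimes>\<^bsub>D\<^esub> c \<otimes>\<^bsub>D\<^esub> f (g \<otimes>\<^bsub>G\<^esub> h) k =
      a \<otimes>\<^bsub>D\<^esub> b \<otimes>\<^bsub>D\<^esub> c \<otimes>\<^bsub>D\<^esub> (f g h \<otimes>\<^bsub>D\<^esub> f (g \<otimes>\<^bsub>G\<^esub> h) k)"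
    by (simp add: D.m_ac)
  also have "\<dots> = a \<otimes>\<^bsub>D\<^esub> b \<otimes>\<^bsub>D\<^esub> c \<otimes>\<^bsub>D\<^esub> (f h k \<otimes>\<^bsub>D\<^esub> f g (h \<otimes>\<^bsub>G\<^esub> k))"
    by (simp add: cocycle)
  also have "\<dots> = a \<otimes>\<^bsub>D\<^esub> (b \<otimes>\<^bsub>D\<^esub> c \<otimes>\<^bsub>D\<^esub> f h k) \<otimes>\<^bsub>D\<^esub> f g (h \<otimes>\<^bsub>G\<^esub> k)"
    by (simp add: D.m_ac)
  finally show "x \<otimes>\<^bsub>E\<^esub> y \<otimes>\<^bsub>E\<^esub> z = x \<otimes>\<^bsub>E\<^esub> (y \<otimes>\<^bsub>E\<^esub> z)"
    by (simp add: G.m_assoc)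
next
  fix x assume "x \<in> carrier E"
  then obtain a g where [simp]: "x = (a, g)" "a \<in> carrier D" "g \<in> carrier G" by auto
  have "inv\<^bsub>D\<^esub> f \<one>\<^bsub>G\<^esub> \<one>\<^bsub>G\<^esub> \<otimes>\<^bsub>D\<^esub> a \<otimes>\<^bsub>D\<^esub> f \<one>\<^bsub>G\<^esub> \<one>\<^bsub>G\<^esub> = a \<otimes>\<^bsub>D\<^esub> (inv\<^bsub>D\<^esub> f \<one>\<^bsub>G\<^esub> \<one>\<^bsub>G\<^esub> \<otimes>\<^bsub>D\<^esub> f \<one>\<^bsub>G\<^esub> \<one>\<^bsub>G\<^esub>)"
    by (simp only: D.m_ac f_closed D.inv_closed G.one_closed \<open>a \<in> carrier D\<close>)
  then show "\<one>\<^bsub>E\<^esub> \<otimes>\<^bsub>E\<^esub> x = x"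
    by (simp add: cocycle_one_left [of g])
  define b where "b = inv\<^bsub>D\<^esub> (a \<otimes>\<^bsub>D\<^esub> f (inv\<^bsub>G\<^esub> g) g) \<otimes>\<^bsub>D\<^esub> inv\<^bsub>D\<^esub> f \<one>\<^bsub>G\<^esub> \<one>\<^bsub>G\<^esub>"
  have [simp]: "b \<in> carrier D" by (simp add: b_def)
  have "b \<otimes>\<^bsub>D\<^esub> a \<otimes>\<^bsub>D\<^esub> f (inv\<^bsub>G\<^esub> g) g = b \<otimes>\<^bsub>D\<^esub> (a \<otimes>\<^bsub>D\<^esub> f (inv\<^bsub>G\<^esub> g) g)"
    by (simp add: D.m_assoc)
  also have "\<dots> = inv\<^bsub>D\<^esub> f \<one>\<^bsub>G\<^esub> \<one>\<^bsub>G\<^esub> \<otimes>\<^bsub>D\<^esub>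
      (inv\<^bsub>D\<^esub> (a \<otimes>\<^bsub>D\<^esub> f (inv\<^bsub>G\<^esub> g) g) \<otimes>\<^bsub>D\<^esub> (a \<otimes>\<^bsub>D\<^esub> f (inv\<^bsub>G\<^esub> g) g))"
    unfolding b_def by (simp only: D.m_ac f_closed D.inv_closed D.m_closed G.inv_closed G.one_closed
      \<open>a \<in> carrier D\<close> \<open>g \<in> carrier G\<close>)
  also have "\<dots> = inv\<^bsub>D\<^esub> f \<one>\<^bsub>G\<^esub> \<one>\<^bsub>G\<^esub>"
    by simp
  finally have "(b, inv\<^bsub>G\<^esub> g) \<otimes>\<^bsub>E\<^esub> x = \<one>\<^bsub>E\<^esub>" by simp
  then show "\<exists>y\<in>carrier E. y \<otimes>\<^bsub>E\<^esub> x = \<one>\<^bsub>E\<^esub>"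
    by (intro bexI [of _ "(b, inv\<^bsub>G\<^esub> g)"]) simp_all
qed auto

lemma group_hom_snd: "group_hom E G snd"
  by (intro group_hom.intro group_hom_axioms.intro group_extension G.group_axioms)
    (auto simp: hom_def)

lemma snd_surj: "snd ` carrier E = carrier G"
  by auto

lemma extension_commute:
  assumes "x \<in> carrier E" "y \<in> carrier E" "snd x \<otimes>\<^bsub>G\<^esub> snd y = snd y \<otimes>\<^bsub>G\<^esub> snd x"
    and "f (snd x) (snd y) = f (snd y) (snd x)"
  shows "x \<otimes>\<^bsub>E\<^esub> y = y \<otimes>\<^bsub>E\<^esub> x"
  using assms by (cases x; cases y) (auto simp: D.m_comm)

text \<open>
  Since \<open>(b, x)\<^sup>2 = (b\<^sup>2 f(x, x), x\<^sup>2)\<close>, a lift that is an involution amounts to a square root in \<open>D\<close>.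
\<close>

lemma extension_involution_lift:
  assumes sqrt: "\<And>a. a \<in> carrier D \<Longrightarrow> \<exists>b\<in>carrier D. b \<otimes>\<^bsub>D\<^esub> b = a"
    and x [simp]: "x \<in> carrier G" and "x \<otimes>\<^bsub>G\<^esub> x = \<one>\<^bsub>G\<^esub>"
  shows "\<exists>e\<in>carrier E. snd e = x \<and> e \<otimes>\<^bsub>E\<^esub> e = \<one>\<^bsub>E\<^esub>"
proof -
  obtain b where "b \<in> carrier D" "b \<otimes>\<^bsub>D\<^esub> b = inv\<^bsub>D\<^esub> f \<one>\<^bsub>G\<^esub> \<one>\<^bsub>G\<^esub> \<otimes>\<^bsub>D\<^esub> inv\<^bsub>D\<^esub> f x x"
    using sqrt [of "inv\<^bsub>D\<^esub> f \<one>\<^bsub>G\<^esub> \<one>\<^bsub>G\<^esub> \<otimes>\<^bsub>D\<^esub> inv\<^bsub>D\<^esub> f x x"] by auto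
  then show ?thesis
    using assms by (intro bexI [of _ "(b, x)"]) (auto simp: D.m_assoc)
qed

lemma section_imp_coboundary:
  assumes \<sigma>: "\<sigma> \<in> hom G E" "\<And>x. x \<in> carrier G \<Longrightarrow> snd (\<sigma> x) = x"
  shows "\<exists>\<phi>. \<phi> ` carrier G \<subseteq> carrier D \<and>
    (\<forall>g\<in>carrier G. \<forall>h\<in>carrier G. \<phi> (g \<otimes>\<^bsub>G\<^esub> h) = \<phi> g \<otimes>\<^bsub>D\<^esub> \<phi> h \<otimes>\<^bsub>D\<^esub> f g h)"
proof (intro exI conjI ballI)
  have carrier: "\<sigma> x \<in> carrier D \<times> carrier G" if "x \<in> carrier G" for x
    using hom_in_carrier [OF \<sigma>(1) that] by simp
  then show "(fst \<circ> \<sigma>) ` carrier G \<subseteq> carrier D"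
    by fastforce
  fix g h assume gh: "g \<in> carrier G" "h \<in> carrier G"
  obtain a b where "\<sigma> g = (a, g)" "\<sigma> h = (b, h)"
    using \<sigma>(2) gh by (metis prod.collapse)
  then show "(fst \<circ> \<sigma>) (g \<otimes>\<^bsub>G\<^esub> h) = (fst \<circ> \<sigma>) g \<otimes>\<^bsub>D\<^esub> (fst \<circ> \<sigma>) h \<otimes>\<^bsub>D\<^esub> f g h"
    using hom_mult [OF \<sigma>(1) gh] by simp
qed

end

section \<open>The bar complex in low degrees\<close>

lemma bar_boundary_zero [simp]: "bar_boundary n G 0 = 0"
  and bar_boundary_add: "bar_boundary n G (c + d) = bar_boundary n G c + bar_boundary n G d"
  and bar_boundary_minus: "bar_boundary n G (- c) = - bar_boundary n G c"
  and bar_boundary_diff: "bar_boundary n G (c - d) = bar_boundary n G c - bar_boundary n G d"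
  by (simp_all add: bar_boundary_def frag_extend_add frag_extend_minus frag_extend_diff)

lemma bar_boundary_2_of:
  "bar_boundary 2 G (frag_of [g, h]) = frag_of [h] - frag_of [g \<otimes>\<^bsub>G\<^esub> h] + frag_of [g]"
  by (simp add: bar_boundary_def bar_face_def numeral_2_eq_2)

lemma bar_boundary_3_of:
  "bar_boundary 3 G (frag_of [g, h, k]) =
    frag_of [h, k] - frag_of [g \<otimes>\<^bsub>G\<^esub> h, k] + frag_of [g, h \<otimes>\<^bsub>G\<^esub> k] - frag_of [g, h]"
  by (simp add: bar_boundary_def bar_face_def numeral_3_eq_3)

lemma bar_simplices_2: "bar_simplices 2 G = {[g, h] | g h. g \<in> carrier G \<and> h \<in> carrier G}"
  by (auto simp: bar_simplices_def numeral_2_eq_2 length_Suc_conv)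

lemma bar_simplices_3:
  "bar_simplices 3 G = {[g, h, k] | g h k. g \<in> carrier G \<and> h \<in> carrier G \<and> k \<in> carrier G}"
  by (auto simp: bar_simplices_def numeral_3_eq_3 length_Suc_conv)

abbreviation "bar_chains n G \<equiv> carrier (bar_chain_group n G)"

lemma chains_iff: "c \<in> bar_chains n G \<longleftrightarrow> Poly_Mapping.keys c \<subseteq> bar_simplices n G"
  by (simp add: bar_chain_group_def)

lemma chains_add: "c \<in> bar_chains n G \<Longrightarrow> d \<in> bar_chains n G \<Longrightarrow> c + d \<in> bar_chains n G"
  and chains_diff: "c \<in> bar_chains n G \<Longrightarrow> d \<in> bar_chains n G \<Longrightarrow> c - d \<in> bar_chains n G"
  using keys_add [of c d] keys_diff [of c d] by (auto simp: chains_iff)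

lemma chains_induct [consumes 1, case_names zero diff simplex]:
  assumes "c \<in> bar_chains n G" "P 0"
    "\<And>c d. c \<in> bar_chains n G \<Longrightarrow> d \<in> bar_chains n G \<Longrightarrow> P c \<Longrightarrow> P d \<Longrightarrow> P (c - d)"
    "\<And>gs. gs \<in> bar_simplices n G \<Longrightarrow> P (frag_of gs)"
  shows "P c"
  using assms by (auto simp: chains_iff intro: free_Abelian_group_induct)

lemma (in group) bar_boundary_3_in_chains:
  assumes "c \<in> bar_chains 3 G"
  shows "bar_boundary 3 G c \<in> bar_chains 2 G"
  using assms
proof (induction rule: chains_induct)
  case (diff c d)
  then show ?case by (simp add: bar_boundary_diff chains_diff)
next
  case (simplex gs)
  then obtain g h k where "gs = [g, h, k]" "g \<in> carrier G" "h \<in> carrier G" "k \<in> carrier G"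
    by (auto simp: bar_simplices_3)
  then show ?case
    unfolding \<open>gs = _\<close> bar_boundary_3_of
    by (intro chains_add chains_diff) (simp_all add: chains_iff bar_simplices_2)
qed (simp add: chains_iff)

lemma (in group) bar_boundary_2_boundary_3:
  assumes "c \<in> bar_chains 3 G"
  shows "bar_boundary 2 G (bar_boundary 3 G c) = 0"
  using assms
proof (induction rule: chains_induct)
  case (simplex gs)
  then show ?case
    by (auto simp: bar_simplices_3 bar_boundary_3_of bar_boundary_2_of bar_boundary_add
        bar_boundary_diff m_assoc)
qed (simp_all add: bar_boundary_diff)

section \<open>The second homology group\<close>

abbreviation "cycles G \<equiv> carrier (bar_cycle_group 2 G)"

abbreviation homology_class where
  "homology_class G z \<equiv> bar_boundaries 2 G #>\<^bsub>bar_cycle_group 2 G\<^esub> z"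

lemma comm_group_chains: "comm_group (bar_chain_group n G)"
  by (simp add: bar_chain_group_def abelian_free_Abelian_group)

lemma cycle_group_simps [simp]:
  "\<one>\<^bsub>bar_cycle_group n G\<^esub> = 0"
  "x \<otimes>\<^bsub>bar_cycle_group n G\<^esub> y = x + y"
  by (simp_all add: bar_cycle_group_def bar_chain_group_def)

lemma subgroup_cycles:
  "subgroup {c \<in> bar_chains n G. bar_boundary n G c = 0} (bar_chain_group n G)"
proof -
  interpret group "bar_chain_group n G"
    by (simp add: bar_chain_group_def)
  have "Poly_Mapping.keys (c + d) \<subseteq> A" if "Poly_Mapping.keys c \<subseteq> A" "Poly_Mapping.keys d \<subseteq> A"
    for c d :: "'a list \<Rightarrow>\<^sub>0 int" and A
    using keys_add [of c d] that by blast
  then show ?thesis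
    by (intro subgroupI) (auto simp: bar_chain_group_def bar_boundary_add bar_boundary_minus
        intro!: exI [of _ 0])
qed

lemma cycles_eq: "carrier (bar_cycle_group n G) = {c \<in> bar_chains n G. bar_boundary n G c = 0}"
  unfolding bar_cycle_group_def by (rule subgroup.carrier_subgroup_generated_subgroup [OF subgroup_cycles])

lemma cyclesI: "c \<in> bar_chains 2 G \<Longrightarrow> bar_boundary 2 G c = 0 \<Longrightarrow> c \<in> cycles G"
  by (simp add: cycles_eq)

lemma comm_group_cycles: "comm_group (bar_cycle_group n G)"
  unfolding bar_cycle_group_def
  by (intro group.abelian_subgroup_generated comm_group_chains comm_group.axioms(2))

locale bar_homology = group G for G (structure)
begin

lemma boundaryI: "c \<in> bar_chains 3 G \<Longrightarrow> bar_boundary 3 G c \<in> bar_boundaries 2 G"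
  by (simp add: bar_boundaries_def eval_nat_numeral)

lemma boundaryE:
  assumes "b \<in> bar_boundaries 2 G"
  obtains c where "c \<in> bar_chains 3 G" "b = bar_boundary 3 G c"
  using assms by (auto simp: bar_boundaries_def eval_nat_numeral)

lemma boundaries_subgroup: "subgroup (bar_boundaries 2 G) (bar_cycle_group 2 G)"
proof -
  interpret Z: comm_group "bar_cycle_group 2 G" by (rule comm_group_cycles)
  show ?thesis
  proof (rule Z.subgroupI)
    show "bar_boundaries 2 G \<subseteq> cycles G"
      by (auto elim!: boundaryE intro!: cyclesI bar_boundary_3_in_chains bar_boundary_2_boundary_3)
    have "0 \<in> bar_chains 3 G" by (simp add: chains_iff)
    then show "bar_boundaries 2 G \<noteq> {}"
      using boundaryI by blast
  next
    fix b assume b: "b \<in> bar_boundaries 2 G"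
    then obtain c where c: "c \<in> bar_chains 3 G" "b = bar_boundary 3 G c" by (rule boundaryE)
    have inv: "inv\<^bsub>bar_cycle_group 2 G\<^esub> b = - b"
    proof (rule Z.inv_equality)
      show *: "b \<in> cycles G"
        using c by (auto intro!: cyclesI bar_boundary_3_in_chains bar_boundary_2_boundary_3)
      show "- b \<in> cycles G"
        using * by (simp add: cycles_eq chains_iff bar_boundary_minus)
    qed simp
    have "- c \<in> bar_chains 3 G" using c by (simp add: chains_iff)
    then show "inv\<^bsub>bar_cycle_group 2 G\<^esub> b \<in> bar_boundaries 2 G"
      using boundaryI [of "- c"] c inv by (simp add: bar_boundary_minus)
  next
    fix b b' assume "b \<in> bar_boundaries 2 G" "b' \<in> bar_boundaries 2 G"
    then show "b \<otimes>\<^bsub>bar_cycle_group 2 G\<^esub> b' \<in> bar_boundaries 2 G"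
      by (auto elim!: boundaryE intro!: boundaryI chains_add simp flip: bar_boundary_add)
  qed
qed

sublocale Z: comm_group "bar_cycle_group 2 G"
  by (rule comm_group_cycles)

sublocale B: normal "bar_boundaries 2 G" "bar_cycle_group 2 G"
  by (rule Z.subgroup_imp_normal [OF boundaries_subgroup])

sublocale H2: comm_group "group_homology 2 G"
  unfolding group_homology_def by (rule Z.abelian_FactGroup [OF boundaries_subgroup])

lemma carrier_H2: "carrier (group_homology 2 G) = homology_class G ` cycles G"
  by (simp add: group_homology_def carrier_FactGroup)

lemma homology_class_hom: "homology_class G \<in> hom (bar_cycle_group 2 G) (group_homology 2 G)"
  unfolding group_homology_def by (rule B.r_coset_hom_Mod)

lemma homology_class_add:
  assumes "y \<in> cycles G" "z \<in> cycles G"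
  shows "homology_class G (y + z) = homology_class G y \<otimes>\<^bsub>group_homology 2 G\<^esub> homology_class G z"
  using hom_mult [OF homology_class_hom assms] by simp

lemma homology_class_boundary:
  assumes "b \<in> bar_boundaries 2 G"
  shows "homology_class G b = \<one>\<^bsub>group_homology 2 G\<^esub>"
  using B.rcos_const [OF Z.group_axioms assms] by (simp add: group_homology_def)

lemma cycles_minus: "z \<in> cycles G \<Longrightarrow> - z \<in> cycles G"
  by (simp add: cycles_eq chains_iff bar_boundary_minus)

lemma homology_class_minus:
  assumes "z \<in> cycles G"
  shows "homology_class G (- z) = inv\<^bsub>group_homology 2 G\<^esub> homology_class G z"
proof -
  have "homology_class G (- z) \<otimes>\<^bsub>group_homology 2 G\<^esub> homology_class G z = homology_class G 0"
    using homology_class_add [OF cycles_minus assms, OF assms] by simp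
  also have "\<dots> = \<one>\<^bsub>group_homology 2 G\<^esub>"
    using homology_class_boundary [of 0] B.one_closed by simp
  finally show ?thesis
    using assms cycles_minus [OF assms] by (intro H2.inv_equality [symmetric]) (auto simp: carrier_H2)
qed

lemma commutator_cycle:
  assumes "g \<in> carrier G" "h \<in> carrier G" "g \<otimes> h = h \<otimes> g"
  shows "frag_of [g, h] - frag_of [h, g] \<in> cycles G"
  using assms
  by (intro cyclesI chains_diff) (simp_all add: chains_iff bar_simplices_2 bar_boundary_diff bar_boundary_2_of)

end

text \<open>
  Integral chains embed into this group by their coefficients. The values are rational because square
  roots of elements, here halves of functions, are needed to lift involutions to involutions.
\<close>

definition function_group :: "('i \<Rightarrow> rat) monoid" where
  "function_group = \<lparr>carrier = UNIV, monoid.mult = (\<lambda>u v x. u x + v x), one = (\<lambda>_. 0)\<rparr>"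

lemma function_group_simps [simp]:
  "carrier function_group = UNIV"
  "u \<otimes>\<^bsub>function_group\<^esub> v = (\<lambda>x. u x + v x)"
  "\<one>\<^bsub>function_group\<^esub> = (\<lambda>_. 0)"
  by (simp_all add: function_group_def)

lemma comm_group_function_group: "comm_group (function_group :: ('i \<Rightarrow> rat) monoid)"
proof (rule comm_groupI)
  fix u :: "'i \<Rightarrow> rat"
  show "\<exists>v\<in>carrier function_group. v \<otimes>\<^bsub>function_group\<^esub> u = \<one>\<^bsub>function_group\<^esub>"
    by (intro bexI [of _ "\<lambda>x. - u x"]) auto
qed (auto simp: algebra_simps)

context bar_homology
begin

text \<open>
  A subgroup \<open>S\<close> of \<open>H\<^sub>2(G)\<close> is everything once the central extension of \<open>G\<close> belonging to \<open>S\<close> splits. The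
  premise \<open>split\<close> lists what may be used of that extension: lifts of commuting elements \<open>g\<close> and \<open>h\<close>
  commute as soon as the class of \<open>[g|h] - [h|g]\<close> is in \<open>S\<close>, and involutions lift to involutions. The
  type of \<open>E\<close> is that of a twisted product of cosets of rational chains with \<open>G\<close>.
\<close>

proposition second_homology_eqI:
  assumes S: "subgroup S (group_homology 2 G)"
    and split: "\<And>E :: (('a list \<Rightarrow> rat) set \<times> 'a) monoid.
      \<lbrakk>group_hom E G snd; snd ` carrier E = carrier G;
       \<And>x y. \<lbrakk>x \<in> carrier E; y \<in> carrier E; snd x \<otimes> snd y = snd y \<otimes> snd x;
          homology_class G (frag_of [snd x, snd y] - frag_of [snd y, snd x]) \<in> S\<rbrakk>
         \<Longrightarrow> x \<otimes>\<^bsub>E\<^esub> y = y \<otimes>\<^bsub>E\<^esub> x;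
       \<And>g. \<lbrakk>g \<in> carrier G; g \<otimes> g = \<one>\<rbrakk> \<Longrightarrow> \<exists>e\<in>carrier E. snd e = g \<and> e \<otimes>\<^bsub>E\<^esub> e = \<one>\<^bsub>E\<^esub>\<rbrakk>
      \<Longrightarrow> \<exists>\<sigma>\<in>hom G E. \<forall>g\<in>carrier G. snd (\<sigma> g) = g"
  shows "S = carrier (group_homology 2 G)"
proof -
  interpret S: subgroup S "group_homology 2 G" by (rule S)
  \<comment> \<open>The coefficients \<open>D\<close> are rational chains modulo \<open>N\<close>, and \<open>F\<close> is the canonical map from integral
      chains to \<open>D\<close>. It is trivial exactly on \<open>N\<close>, since integral chains embed into rational ones.\<close>
  define N where "N = {z \<in> cycles G. homology_class G z \<in> S}"
  have N_add: "y + z \<in> N" if "y \<in> N" "z \<in> N" for y z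
    using that homology_class_add [of y z] Z.m_closed [of y z] by (auto simp: N_def)
  have N_minus: "- z \<in> N" if "z \<in> N" for z
    using that homology_class_minus [of z] cycles_minus [of z] by (auto simp: N_def)
  have N_boundary: "b \<in> N" if "b \<in> bar_boundaries 2 G" for b
    using that B.subset homology_class_boundary [OF that] by (auto simp: N_def)
  let ?V = "function_group :: ('a list \<Rightarrow> rat) monoid"
  define \<iota> :: "('a list \<Rightarrow>\<^sub>0 int) \<Rightarrow> 'a list \<Rightarrow> rat"
    where "\<iota> c = (\<lambda>gs. of_int (Poly_Mapping.lookup c gs))" for c
  have \<iota>_add: "\<iota> (c + d) = (\<lambda>x. \<iota> c x + \<iota> d x)" for c d
    by (simp add: \<iota>_def lookup_add)
  have \<iota>_inj: "c = d" if "\<iota> c = \<iota> d" for c d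
    using that by (auto simp: \<iota>_def fun_eq_iff intro: poly_mapping_eqI)
  interpret V: comm_group ?V by (rule comm_group_function_group)
  have subgroup_N: "subgroup (\<iota> ` N) ?V"
  proof (rule V.subgroupI)
    show "\<iota> ` N \<noteq> {}" using N_boundary B.one_closed by auto
    fix u assume "u \<in> \<iota> ` N"
    then obtain z where z: "z \<in> N" "u = \<iota> z" by auto
    have "inv\<^bsub>?V\<^esub> u = \<iota> (- z)"
      by (rule V.inv_equality) (auto simp: z \<iota>_def)
    then show "inv\<^bsub>?V\<^esub> u \<in> \<iota> ` N" using N_minus z by auto
  next
    fix u v assume "u \<in> \<iota> ` N" "v \<in> \<iota> ` N"
    then show "u \<otimes>\<^bsub>?V\<^esub> v \<in> \<iota> ` N"
      using N_add by (auto simp flip: \<iota>_add)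
  qed simp
  interpret N: normal "\<iota> ` N" ?V by (rule V.subgroup_imp_normal [OF subgroup_N])
  define D where "D = ?V Mod (\<iota> ` N)"
  interpret D: comm_group D
    unfolding D_def by (rule V.abelian_FactGroup [OF subgroup_N])
  define F where "F c = \<iota> ` N #>\<^bsub>?V\<^esub> \<iota> c" for c
  have F_closed [simp]: "F c \<in> carrier D" for c
    by (auto simp: F_def D_def carrier_FactGroup)
  have F_add: "F (c + d) = F c \<otimes>\<^bsub>D\<^esub> F d" for c d
    using N.rcos_sum [of "\<iota> c" "\<iota> d"] by (simp add: F_def D_def \<iota>_add)
  have F_one_iff: "F c = \<one>\<^bsub>D\<^esub> \<longleftrightarrow> c \<in> N" for c
  proof
    assume "F c = \<one>\<^bsub>D\<^esub>"
    then have "\<iota> c \<in> \<iota> ` N"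
      using V.coset_join1 [OF _ _ subgroup_N] by (simp add: F_def D_def)
    then show "c \<in> N" using \<iota>_inj by auto
  next
    assume "c \<in> N"
    then show "F c = \<one>\<^bsub>D\<^esub>"
      using V.coset_join2 [OF _ subgroup_N] by (simp add: F_def D_def)
  qed
  have F_eqI: "F c = F d" if "c - d \<in> N" for c d
    using F_add [of "c - d" d] that by (simp add: F_one_iff [symmetric])
  have F_zero: "F 0 = \<one>\<^bsub>D\<^esub>"
    using N_boundary B.one_closed by (simp add: F_one_iff)
  define f where "f g h = F (frag_of [g, h])" for g h
  interpret cocycle D G f
  proof
    fix g h k assume ghk: "g \<in> carrier G" "h \<in> carrier G" "k \<in> carrier G"
    have "frag_of [g, h, k] \<in> bar_chains 3 G"
      using ghk by (simp add: chains_iff bar_simplices_3)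
    then have "bar_boundary 3 G (frag_of [g, h, k]) \<in> N"
      by (intro N_boundary boundaryI)
    then have "F (frag_of [h, k] + frag_of [g, h \<otimes> k]) = F (frag_of [g, h] + frag_of [g \<otimes> h, k])"
      by (intro F_eqI) (simp add: bar_boundary_3_of algebra_simps)
    then show "f g h \<otimes>\<^bsub>D\<^esub> f (g \<otimes> h) k = f h k \<otimes>\<^bsub>D\<^esub> f g (h \<otimes> k)"
      by (simp add: f_def F_add)
  qed (simp add: f_def)
  have "\<exists>\<sigma>\<in>hom G E. \<forall>g\<in>carrier G. snd (\<sigma> g) = g"
  proof (rule split)
    show "group_hom E G snd" by (rule group_hom_snd)
    show "snd ` carrier E = carrier G" by (rule snd_surj)
  next
    fix x y
    assume xy: "x \<in> carrier E" "y \<in> carrier E" "snd x \<otimes> snd y = snd y \<otimes> snd x"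
      and "homology_class G (frag_of [snd x, snd y] - frag_of [snd y, snd x]) \<in> S"
    moreover have "snd x \<in> carrier G" "snd y \<in> carrier G" using xy by auto
    ultimately have "frag_of [snd x, snd y] - frag_of [snd y, snd x] \<in> N"
      by (simp add: N_def commutator_cycle)
    then have "f (snd x) (snd y) = f (snd y) (snd x)"
      unfolding f_def by (rule F_eqI)
    then show "x \<otimes>\<^bsub>E\<^esub> y = y \<otimes>\<^bsub>E\<^esub> x"
      using xy by (intro extension_commute)
  next
    fix g assume g: "g \<in> carrier G" "g \<otimes> g = \<one>"
    have "\<exists>b\<in>carrier D. b \<otimes>\<^bsub>D\<^esub> b = a" if a_in: "a \<in> carrier D" for a
    proof -
      obtain v where a: "a = \<iota> ` N #>\<^bsub>?V\<^esub> v"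
        using a_in by (auto simp: D_def carrier_FactGroup)
      have "(\<iota> ` N #>\<^bsub>?V\<^esub> (\<lambda>x. v x / 2)) \<otimes>\<^bsub>D\<^esub> (\<iota> ` N #>\<^bsub>?V\<^esub> (\<lambda>x. v x / 2)) = a"
        using N.rcos_sum [of "\<lambda>x. v x / 2" "\<lambda>x. v x / 2"] by (simp add: D_def a)
      then show ?thesis
        by (auto simp: D_def carrier_FactGroup)
    qed
    then show "\<exists>e\<in>carrier E. snd e = g \<and> e \<otimes>\<^bsub>E\<^esub> e = \<one>\<^bsub>E\<^esub>"
      using g by (intro extension_involution_lift)
  qed
  then obtain \<sigma> where "\<sigma> \<in> hom G E" "\<And>g. g \<in> carrier G \<Longrightarrow> snd (\<sigma> g) = g" by blast
  then obtain \<phi> where \<phi>: "\<phi> ` carrier G \<subseteq> carrier D"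
    and \<phi>_mult: "\<forall>g\<in>carrier G. \<forall>h\<in>carrier G. \<phi> (g \<otimes> h) = \<phi> g \<otimes>\<^bsub>D\<^esub> \<phi> h \<otimes>\<^bsub>D\<^esub> f g h"
    using section_imp_coboundary by metis
  have \<phi>_closed [simp]: "\<phi> g \<in> carrier D" if "g \<in> carrier G" for g
    using \<phi> that by auto
  have "range (\<lambda>gs. if hd gs \<in> carrier G then inv\<^bsub>D\<^esub> \<phi> (hd gs) else \<one>\<^bsub>D\<^esub>) \<subseteq> carrier D"
    by auto
  then obtain \<Phi> where \<Phi>: "\<Phi> \<in> hom (free_Abelian_group (UNIV :: 'a list set)) D"
    and "\<And>gs. \<Phi> (frag_of gs) = (if hd gs \<in> carrier G then inv\<^bsub>D\<^esub> \<phi> (hd gs) else \<one>\<^bsub>D\<^esub>)"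
    by (rule D.free_Abelian_group_universal) auto
  then have \<Phi>_of: "\<Phi> (frag_of [g]) = inv\<^bsub>D\<^esub> \<phi> g" if "g \<in> carrier G" for g
    using that by simp
  have \<Phi>_closed [simp]: "\<Phi> c \<in> carrier D" for c
    using hom_in_carrier [OF \<Phi>, of c] by simp
  have \<Phi>_add: "\<Phi> (c + d) = \<Phi> c \<otimes>\<^bsub>D\<^esub> \<Phi> d" for c d
    using hom_mult [OF \<Phi>, of c d] by simp
  have \<Phi>_zero: "\<Phi> 0 = \<one>\<^bsub>D\<^esub>"
    using \<Phi>_add [of 0 0] by (simp add: D.l_cancel_one')
  \<comment> \<open>A section provides \<open>\<phi>\<close> whose inverse has coboundary \<open>f\<close>; the linear
      extension \<open>\<Phi>\<close> of that inverse to \<open>1\<close>-chains expresses \<open>F\<close> through the boundary, so that \<open>F\<close> is trivial on cycles.\<close>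
  have F_boundary: "F c = \<Phi> (bar_boundary 2 G c)" if "c \<in> bar_chains 2 G" for c
    using that
  proof (induction rule: chains_induct)
    case zero
    show ?case by (simp add: F_zero \<Phi>_zero)
  next
    case (diff c d)
    have "F (c - d) \<otimes>\<^bsub>D\<^esub> F d = \<Phi> (bar_boundary 2 G (c - d)) \<otimes>\<^bsub>D\<^esub> F d"
      using F_add [of "c - d" d] \<Phi>_add [of "bar_boundary 2 G (c - d)" "bar_boundary 2 G d"] diff
      by (simp flip: bar_boundary_add)
    then show ?case by simp
  next
    case (simplex gs)
    then obtain g h where gs: "gs = [g, h]" and [simp]: "g \<in> carrier G" "h \<in> carrier G"
      by (auto simp: bar_simplices_2)
    have [simp]: "f g h \<in> carrier D" by (simp add: f_def)
    let ?x = "bar_boundary 2 G (frag_of gs)"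
    have "\<Phi> ?x \<otimes>\<^bsub>D\<^esub> \<Phi> (frag_of [g \<otimes> h]) = \<Phi> (frag_of [h] + frag_of [g])"
      by (simp add: gs bar_boundary_2_of algebra_simps flip: \<Phi>_add)
    also have "\<dots> = inv\<^bsub>D\<^esub> (\<phi> g \<otimes>\<^bsub>D\<^esub> \<phi> h)"
      by (simp add: \<Phi>_add \<Phi>_of D.inv_mult_group)
    also have "\<dots> = f g h \<otimes>\<^bsub>D\<^esub> inv\<^bsub>D\<^esub> (\<phi> g \<otimes>\<^bsub>D\<^esub> \<phi> h \<otimes>\<^bsub>D\<^esub> f g h)"
      by (simp add: D.inv_mult_group D.inv_mult_cancel)
    also have "\<dots> = F (frag_of gs) \<otimes>\<^bsub>D\<^esub> \<Phi> (frag_of [g \<otimes> h])"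
      by (simp add: \<Phi>_of \<phi>_mult gs flip: f_def)
    finally show ?case by simp
  qed
  have "homology_class G z \<in> S" if z: "z \<in> cycles G" for z
  proof -
    have "F z = \<one>\<^bsub>D\<^esub>"
      using z F_boundary [of z] by (simp add: cycles_eq \<Phi>_zero)
    then show ?thesis by (simp add: F_one_iff N_def)
  qed
  then show ?thesis
    using S.subset by (auto simp: carrier_H2)
qed

end

section \<open>Functoriality and toral classes\<close>

lemma bar_map_diff: "bar_map \<phi> (c - d) = bar_map \<phi> c - bar_map \<phi> d"
  and bar_map_add: "bar_map \<phi> (c + d) = bar_map \<phi> c + bar_map \<phi> d"
  and bar_map_of: "bar_map \<phi> (frag_of gs) = frag_of (map \<phi> gs)"
  and bar_map_zero: "bar_map \<phi> 0 = 0"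
  by (simp_all add: bar_map_def frag_extend_diff frag_extend_add)

lemma bar_map_in_chains:
  assumes "\<phi> \<in> hom H G" "c \<in> bar_chains n H"
  shows "bar_map \<phi> c \<in> bar_chains n G"
  using assms(2)
proof (induction rule: chains_induct)
  case (simplex gs)
  then show ?case
    using hom_in_carrier [OF assms(1)] by (auto simp: bar_map_of chains_iff bar_simplices_def)
qed (simp_all add: bar_map_diff chains_diff, simp add: bar_map_zero chains_iff)

lemma bar_map_boundary_2:
  assumes "\<phi> \<in> hom H G" "c \<in> bar_chains 2 H"
  shows "bar_boundary 2 G (bar_map \<phi> c) = bar_map \<phi> (bar_boundary 2 H c)"
  using assms(2)
proof (induction rule: chains_induct)
  case (simplex gs)
  then show ?case
    using assms(1) by (auto simp: bar_simplices_2 bar_boundary_2_of bar_map_of bar_map_diff bar_map_add hom_mult)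
qed (simp_all add: bar_map_diff bar_boundary_diff bar_map_zero)

lemma bar_map_boundary_3:
  assumes "\<phi> \<in> hom H G" "c \<in> bar_chains 3 H"
  shows "bar_boundary 3 G (bar_map \<phi> c) = bar_map \<phi> (bar_boundary 3 H c)"
  using assms(2)
proof (induction rule: chains_induct)
  case (simplex gs)
  then show ?case
    using assms(1) by (auto simp: bar_simplices_3 bar_boundary_3_of bar_map_of bar_map_diff bar_map_add hom_mult)
qed (simp_all add: bar_map_diff bar_boundary_diff bar_map_zero)

lemma bar_map_in_cycles:
  assumes "\<phi> \<in> hom H G" "z \<in> cycles H"
  shows "bar_map \<phi> z \<in> cycles G"
  using assms bar_map_boundary_2 [OF assms(1), of z] bar_map_in_chains [OF assms(1), of z 2]
  by (simp add: cycles_eq bar_map_zero)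

text \<open>
  The induced map picks the only element of the image of a coset, so it has to be checked that the
  image of a boundary is a boundary.
\<close>

lemma group_homology_map_class:
  assumes "bar_homology H" "bar_homology G" and \<phi>: "\<phi> \<in> hom H G" and z: "z \<in> cycles H"
  shows "group_homology_map 2 G \<phi> (homology_class H z) = homology_class G (bar_map \<phi> z)"
proof -
  interpret H: bar_homology H by fact
  interpret G: bar_homology G by fact
  have "homology_class G (bar_map \<phi> c) = homology_class G (bar_map \<phi> z)"
    if c_in: "c \<in> homology_class H z" for c
  proof -
    obtain b where b: "b \<in> bar_boundaries 2 H" and c: "c = b + z"
      using c_in by (auto simp: r_coset_def)
    have "bar_map \<phi> b \<in> bar_boundaries 2 G"
      using H.boundaryE [OF b] G.boundaryI bar_map_in_chains [OF \<phi>] bar_map_boundary_3 [OF \<phi>] by metis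
    moreover have "b \<in> cycles H" using b H.B.subset by auto
    ultimately show ?thesis
      using bar_map_in_cycles [OF \<phi>] z
      by (simp add: c bar_map_add G.homology_class_add G.homology_class_boundary G.carrier_H2)
  qed
  moreover have "z \<in> homology_class H z"
    using z by (intro H.Z.rcos_self H.boundaries_subgroup)
  ultimately have "(\<lambda>c. homology_class G (bar_map \<phi> c)) ` homology_class H z = {homology_class G (bar_map \<phi> z)}"
    by blast
  then show ?thesis
    by (simp add: group_homology_map_def)
qed

lemma (in group) int_pow_commute:
  assumes "x \<otimes> y = y \<otimes> x" and [simp]: "x \<in> carrier G" "y \<in> carrier G"
  shows "x [^] (n::int) \<otimes> y = y \<otimes> x [^] n"
proof -
  have nat: "x [^] k \<otimes> y = y \<otimes> x [^] k" for k :: nat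
    using assms by (intro group_commutes_pow)
  have "inv (x [^] k) \<otimes> y = y \<otimes> inv (x [^] k)" for k :: nat
  proof -
    have "inv (x [^] k) \<otimes> y = inv (x [^] k) \<otimes> (y \<otimes> x [^] k) \<otimes> inv (x [^] k)"
      by (simp add: m_assoc)
    also have "\<dots> = y \<otimes> inv (x [^] k)"
      by (simp add: inv_mult_cancel flip: nat add: m_assoc)
    finally show ?thesis .
  qed
  moreover obtain k where "n = int k \<or> n = - int k"
    by (metis int_cases2)
  ultimately show ?thesis
    using nat by (auto simp: int_pow_int int_pow_neg_int)
qed

lemma (in group) hom_integer_square:
  assumes ab: "a \<otimes> b = b \<otimes> a" and [simp]: "a \<in> carrier G" "b \<in> carrier G"
  shows "(\<lambda>(m, n). a [^] m \<otimes> b [^] n) \<in> hom integer_square G"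
proof (rule homI)
  fix x y :: "int \<times> int"
  obtain m n m' n' where [simp]: "x = (m, n)" "y = (m', n')" by force
  have "a [^] m' \<otimes> b = b \<otimes> a [^] m'"
    by (rule int_pow_commute) (simp_all add: ab)
  then have comm: "b [^] n \<otimes> a [^] m' = a [^] m' \<otimes> b [^] n"
    by (intro int_pow_commute) simp_all
  have "a [^] (m + m') \<otimes> b [^] (n + n') = a [^] m \<otimes> (a [^] m' \<otimes> b [^] n) \<otimes> b [^] n'"
    by (simp add: int_pow_mult m_assoc)
  also have "\<dots> = a [^] m \<otimes> b [^] n \<otimes> (a [^] m' \<otimes> b [^] n')"
    by (simp add: m_assoc flip: comm)
  finally show "(case x \<otimes>\<^bsub>integer_square\<^esub> y of (m, n) \<Rightarrow> a [^] m \<otimes> b [^] n) =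
      (case x of (m, n) \<Rightarrow> a [^] m \<otimes> b [^] n) \<otimes> (case y of (m, n) \<Rightarrow> a [^] m \<otimes> b [^] n)"
    by simp
qed auto

abbreviation "torus_cycle \<equiv> frag_of [(1, 0), (0, 1)] - frag_of [(0, 1), (1, 0 :: int) :: int \<times> int]"

interpretation square: bar_homology integer_square
  by (intro bar_homology.intro DirProd_group group_integer_group)

lemma torus_cycle: "torus_cycle \<in> cycles integer_square"
  by (rule square.commutator_cycle) simp_all

text \<open>
  An extension of \<open>\<int> \<times> \<int>\<close> splits if some lifts \<open>a\<close> and \<open>b\<close> of the two generators commute: map
  \<open>(m, n)\<close> to \<open>a\<^sup>m b\<^sup>n\<close>. In the extension belonging to the subgroup generated by the class of the
  torus cycle such lifts do commute.
\<close>

lemma torus_orientation_class_torus_cycle: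
  "torus_orientation_class (homology_class integer_square torus_cycle)"
proof -
  let ?t = "homology_class integer_square torus_cycle"
  let ?S = "generate (group_homology 2 integer_square) {?t}"
  have t: "?t \<in> carrier (group_homology 2 integer_square)"
    using torus_cycle by (auto simp: square.carrier_H2)
  have "?S = carrier (group_homology 2 integer_square)"
  proof (rule square.second_homology_eqI)
    show "subgroup ?S (group_homology 2 integer_square)"
      using t by (intro square.H2.generate_is_subgroup) simp
  next
    fix E :: "(((int \<times> int) list \<Rightarrow> rat) set \<times> int \<times> int) monoid"
    assume "group_hom E integer_square snd" and surj: "snd ` carrier E = carrier integer_square"
      and comm: "\<And>x y. \<lbrakk>x \<in> carrier E; y \<in> carrier E;
         snd x \<otimes>\<^bsub>integer_square\<^esub> snd y = snd y \<otimes>\<^bsub>integer_square\<^esub> snd x;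
         homology_class integer_square (frag_of [snd x, snd y] - frag_of [snd y, snd x]) \<in> ?S\<rbrakk>
        \<Longrightarrow> x \<otimes>\<^bsub>E\<^esub> y = y \<otimes>\<^bsub>E\<^esub> x"
    interpret group_hom E integer_square snd by fact
    have "(1, 0) \<in> snd ` carrier E" "(0, 1) \<in> snd ` carrier E"
      unfolding surj by simp_all
    then obtain a b where a: "a \<in> carrier E" "(1, 0) = snd a" and b: "b \<in> carrier E" "(0, 1) = snd b"
      by blast
    note snd_ab [simp] = a(2) [symmetric] b(2) [symmetric]
    have "?t \<in> ?S" by (rule generate.incl) simp
    then have "a \<otimes>\<^bsub>E\<^esub> b = b \<otimes>\<^bsub>E\<^esub> a"
      using a(1) b(1) by (intro comm) simp_all
    then have hom: "(\<lambda>(m, n). a [^]\<^bsub>E\<^esub> m \<otimes>\<^bsub>E\<^esub> b [^]\<^bsub>E\<^esub> n) \<in> hom integer_square E"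
      using a(1) b(1) by (intro G.hom_integer_square)
    have pow: "x [^]\<^bsub>integer_square\<^esub> k = (k * fst x, k * snd x)" for x and k :: int
    proof -
      have hom: "fst \<in> hom integer_square integer_group" "snd \<in> hom integer_square integer_group"
        by (auto simp: hom_def)
      have "fst (x [^]\<^bsub>integer_square\<^esub> k) = fst x [^]\<^bsub>integer_group\<^esub> k"
        "snd (x [^]\<^bsub>integer_square\<^esub> k) = snd x [^]\<^bsub>integer_group\<^esub> k"
        using Group.hom_int_pow [OF hom(1), of x k] Group.hom_int_pow [OF hom(2), of x k]
          square.group_axioms by simp_all
      then show ?thesis by (simp add: prod_eq_iff)
    qed
    have "snd (a [^]\<^bsub>E\<^esub> m \<otimes>\<^bsub>E\<^esub> b [^]\<^bsub>E\<^esub> n) = (m, n)" for m n :: int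
      using a(1) b(1) by (simp add: hom_int_pow pow)
    with hom show "\<exists>\<sigma>\<in>hom integer_square E. \<forall>g\<in>carrier integer_square. snd (\<sigma> g) = g"
      by (intro bexI [OF _ hom]) auto
  qed
  with t show ?thesis
    by (simp add: torus_orientation_class_def)
qed

context bar_homology
begin

lemma toral_classes_subset: "toral_classes G \<subseteq> carrier (group_homology 2 G)"
proof
  fix c assume "c \<in> toral_classes G"
  then obtain \<phi> z where "\<phi> \<in> hom integer_square G" "z \<in> cycles integer_square"
    "c = group_homology_map 2 G \<phi> (homology_class integer_square z)"
    by (auto simp: toral_classes_def torus_orientation_class_def square.carrier_H2)
  then have "c = homology_class G (bar_map \<phi> z)" "bar_map \<phi> z \<in> cycles G"
    using group_homology_map_class [OF square.bar_homology_axioms bar_homology_axioms] bar_map_in_cycles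
    by metis+
  then show "c \<in> carrier (group_homology 2 G)"
    unfolding carrier_H2 by blast
qed

lemma commutator_cycle_toral:
  assumes [simp]: "g \<in> carrier G" "h \<in> carrier G" and comm: "g \<otimes> h = h \<otimes> g"
  shows "homology_class G (frag_of [g, h] - frag_of [h, g]) \<in> toral_classes G"
proof -
  define \<phi> where "\<phi> = (\<lambda>(m :: int, n :: int). g [^] m \<otimes> h [^] n)"
  have \<phi>: "\<phi> \<in> hom integer_square G"
    unfolding \<phi>_def by (rule hom_integer_square) (simp_all add: comm)
  have "bar_map \<phi> torus_cycle = frag_of [g, h] - frag_of [h, g]"
    by (simp add: bar_map_diff bar_map_of \<phi>_def)
  then have "homology_class G (frag_of [g, h] - frag_of [h, g]) =
      group_homology_map 2 G \<phi> (homology_class integer_square torus_cycle)"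
    using group_homology_map_class [OF square.bar_homology_axioms bar_homology_axioms \<phi> torus_cycle] by simp
  then show ?thesis
    using \<phi> torus_orientation_class_torus_cycle unfolding toral_classes_def by blast
qed

end


section \<open>Finite Coxeter groups\<close>

theorem mainTheorem1:
  fixes G :: "('a, 'b) monoid_scheme"
  assumes "finite_coxeter_group G"
  shows "trivial_group (bogomolov_multiplier G) \<and>
    carrier (schur_multiplier G) = generate (schur_multiplier G) (toral_classes G)"
proof -
  obtain n m where "group G" and cox: "coxeter_matrix n m"
      "G \<cong> presented_group {1..n} (coxeter_relators n m)"
    using assms by (auto simp: finite_coxeter_group_def)
  interpret bar_homology G
    using \<open>group G\<close> by (rule bar_homology.intro)
  let ?S = "generate (group_homology 2 G) (toral_classes G)"
  have S: "?S = carrier (group_homology 2 G)"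
  proof (rule second_homology_eqI)
    show "subgroup ?S (group_homology 2 G)"
      by (rule H2.generate_is_subgroup [OF toral_classes_subset])
  next
    fix E :: "(('a list \<Rightarrow> rat) set \<times> 'a) monoid"
    assume "group_hom E G snd" and "snd ` carrier E = carrier G"
      and comm: "\<And>x y. \<lbrakk>x \<in> carrier E; y \<in> carrier E; snd x \<otimes>\<^bsub>G\<^esub> snd y = snd y \<otimes>\<^bsub>G\<^esub> snd x;
          homology_class G (frag_of [snd x, snd y] - frag_of [snd y, snd x]) \<in> ?S\<rbrakk>
         \<Longrightarrow> x \<otimes>\<^bsub>E\<^esub> y = y \<otimes>\<^bsub>E\<^esub> x"
      and invol: "\<And>g. \<lbrakk>g \<in> carrier G; g \<otimes>\<^bsub>G\<^esub> g = \<one>\<^bsub>G\<^esub>\<rbrakk>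
         \<Longrightarrow> \<exists>e\<in>carrier E. snd e = g \<and> e \<otimes>\<^bsub>E\<^esub> e = \<one>\<^bsub>E\<^esub>"
    interpret group_hom E G snd by fact
    have "commuting_extension E G snd"
    proof
      fix x y
      assume xy: "x \<in> carrier E" "y \<in> carrier E" "snd x \<otimes>\<^bsub>G\<^esub> snd y = snd y \<otimes>\<^bsub>G\<^esub> snd x"
      have "homology_class G (frag_of [snd x, snd y] - frag_of [snd y, snd x]) \<in> ?S"
        using xy by (intro generate.incl commutator_cycle_toral) simp_all
      with xy show "x \<otimes>\<^bsub>E\<^esub> y = y \<otimes>\<^bsub>E\<^esub> x"
        by (intro comm)
    qed (use \<open>snd ` carrier E = carrier G\<close> invol in auto)
    then show "\<exists>\<sigma>\<in>hom G E. \<forall>g\<in>carrier G. snd (\<sigma> g) = g"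
      using cox by (rule coxeter_extension_splits)
  qed
  have sub: "subgroup (carrier (group_homology 2 G)) (group_homology 2 G)"
    by (rule H2.subgroup_self)
  interpret Q: comm_group "group_homology 2 G Mod carrier (group_homology 2 G)"
    by (rule H2.abelian_FactGroup [OF sub])
  have "carrier (group_homology 2 G Mod carrier (group_homology 2 G)) \<subseteq> {carrier (group_homology 2 G)}"
    using H2.coset_join2 [OF _ sub] by (auto simp: carrier_FactGroup)
  then have "trivial_group (group_homology 2 G Mod carrier (group_homology 2 G))"
    using Q.trivial_group_subset by simp
  then show ?thesis
    by (simp add: bogomolov_multiplier_def toral_subgroup_def schur_multiplier_def S)
qed

end
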